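(* Let the data $X,K,X_j,\gamma_j,A,Y,\varphi,j,f,R,q,a_S$ satisfy the standing assumptions listed in the context, and let $j_c:X_j\to X_j^*$ be a linear operator such that $\|j_c(z)\|_{X_j^*}\le\alpha_c\|z\|_{X_j}$ and $\langle j_c(z),z\rangle_{X_j}\ge\alpha_j\|z\|_{X_j}^2$ for all $z\in X_j$. Assume $$\alpha_\varphi+\alpha_cc_j^2<m_A/3,$$ $q\in C^2(\mathbb R_+\times\mathbb R_+;\mathcal L(X))$, and that the solution $u\in C(\mathbb R_+;K)$ of the continuous problem stated in the context satisfies $u\in W^{2,\infty}_{loc}(\mathbb R_+;X)$. Fix $T>0$. For a positive integer $N$ and $k=T/N$ let $u^k=\{u_n^k\}_{n=0}^N\subset K$ be such that for every $2\le n\le N$ and every $v\in K$, $$\langle Au_n^k,v-u_n^k\rangle+\varphi(\mathcal S_{n,L}^ku^k,2u_{n-1}^k-u_{n-2}^k,v)-\varphi(\mathcal S_{n,L}^ku^k,2u_{n-1}^k-u_{n-2}^k,u_n^k)+j^0(\gamma_ju_n^k;\gamma_jv-\gamma_ju_n^k)$$ $$+\langle j_c(\gamma_ju_n^k),\gamma_jv-\gamma_ju_n^k\rangle_{X_j}\ge\langle j_c(2\gamma_ju_{n-1}^k-\gamma_ju_{n-2}^k),\gamma_jv-\gamma_ju_n^k\rangle_{X_j}+\langle f_n,v-u_n^k\rangle,$$ and for $n=0$ and $n=1$ and every $v\in K$, $$\langle Au_n^k,v-u_n^k\rangle+\varphi(\mathcal S_{n,L}^ku^k,u_n^k,v)-\varphi(\mathcal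 S_{n,L}^ku^k,u_n^k,u_n^k)+j^0(\gamma_ju_n^k;\gamma_jv-\gamma_ju_n^k)\ge\langle f_n,v-u_n^k\rangle.$$ Then there is a constant $C_5>0$ independent of $k$ such that, with $u_n=u(t_n)$, $$\max_{n\le N}\|u_n-u_n^k\|_X\le C_5k^2.$$
   Context: Notation. All spaces are real. $\mathbb R_+=[0,\infty)$; $X^*,X_j^*$ are topological duals; $\langle\cdot,\cdot\rangle$ is the duality pairing between $X^*$ and $X$, $\langle\cdot,\cdot\rangle_{X_j}$ the one between $X_j^*$ and $X_j$; $\mathcal L(\cdot;\cdot)$ denotes bounded linear operators, $\mathcal L(X)=\mathcal L(X;X)$. For a locally Lipschitz $j:X_j\to\mathbb R$, the Clarke directional derivative is $j^0(x;v)=\limsup_{y\to x,\lambda\downarrow0}\frac{j(y+\lambda v)-j(y)}{\lambda}$ and $\partial j(x)=\{\xi\in X_j^*: j^0(x;v)\ge\langle\xi,v\rangle_{X_j}\ \forall v\in X_j\}$. Standing assumptions on the data. $X$ is a reflexive Banach space, $K\subset X$ is closed and convex, $0\in K$. $X_j$ is a Banach space, $\gamma_j\in\mathcal L(X;X_j)$ and $c_j>0$ satisfies $\|\gamma_jv\|_{X_j}\le c_j\|v\|_X$ for all $v\in X$. $A:X\to X^*$ is Lipschitz continuous with constant $L_A>0$ and strongly monotone: $\langle Av_1-Av_2,v_1-v_2\rangle\ge m_A\|v_1-v_2\|_X^2$ for all $v_1,v_2\in X$, with $m_A>0$. $Y$ is a normed space and $\varphi:Y\times K\times K\to\mathbb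 R$ is such that $\varphi(y,u,\cdot)$ is convex and lower semicontinuous on $K$ for all $y\in Y,u\in K$, and there are $\alpha_\varphi>0,\beta_\varphi>0$ with $\varphi(y_1,u_1,v_2)-\varphi(y_1,u_1,v_1)+\varphi(y_2,u_2,v_1)-\varphi(y_2,u_2,v_2)\le\alpha_\varphi\|u_1-u_2\|_X\|v_1-v_2\|_X+\beta_\varphi\|y_1-y_2\|_Y\|v_1-v_2\|_X$ for all $y_1,y_2\in Y$, $u_1,u_2,v_1,v_2\in K$. The function $j:X_j\to\mathbb R$ is locally Lipschitz; there are $c_0,c_1\ge0$ with $\|\xi\|_{X_j^*}\le c_0+c_1\|z\|_{X_j}$ for all $z\in X_j$, $\xi\in\partial j(z)$; there is $\alpha_j>0$ with $j^0(z_1;z_2-z_1)+j^0(z_2;z_1-z_2)\le\alpha_j\|z_1-z_2\|_{X_j}^2$ for all $z_1,z_2\in X_j$. $f\in C(\mathbb R_+;X^* )$. $R\in\mathcal L(X;Y)$, $q\in C(\mathbb R_+\times\mathbb R_+;\mathcal L(X))$, $a_S\in X$; these define the history-dependent operator $(\mathcal Sv)(t)=R\left(\int_0^tq(t,s)v(s)\,ds+a_S\right)$ for $v\in C(\mathbb R_+;X)$. Continuous problem. Find $u\in C(\mathbb R_+;K)$ such that for all $t\in\mathbb R_+$ and all $v\in K$, $\langle Au(t),v-u(t)\rangle+\varphi((\mathcal Su)(t),u(t),v)-\varphi((\mathcal Su)(t),u(t),u(t))+j^0(\gamma_ju(t);\gamma_jv-\gamma_ju(t))\ge\langle f(t),v-u(t)\rangle$.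 Time discretization. $t_n=nk$, $0\le n\le N$, $f_n=f(t_n)$. For a sequence $v=\{v_n\}$ in $X$ and $n\ge1$, $\mathcal S_{n,L}^kv=R\left(\frac k2q(t_n,t_0)v_0+k\sum_{i=1}^{n-1}q(t_n,t_i)v_i+\frac k2q(t_n,t_{n-1})v_{n-1}+a_S\right)$ (empty sum $=0$), and $\mathcal S_{0,L}^kv=R\,a_S$.
   Formalization: The formal theorem requires 2u_{n-1}^k − u_{n-2}^k ∈ K for 2 ≤ n ≤ N, since φ is defined only on Y×K×K and the scheme's inequality is otherwise undefined; it also states α_c ≥ 0, which is automatic unless X_j = {0}. *)

theory Defs
  imports "HOL-Analysis.Analysis"
begin

text \<open>The topological dual of a space of type \<open>'a\<close> is \<open>'a \<Rightarrow>\<^sub>L real\<close> with the operator norm.\<close>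

definition reflexive_space :: "'a::real_normed_vector itself \<Rightarrow> bool" where
  "reflexive_space _ \<longleftrightarrow>
     (\<forall>F :: ('a \<Rightarrow>\<^sub>L real) \<Rightarrow>\<^sub>L real. \<exists>x :: 'a. \<forall>\<xi>. blinfun_apply F \<xi> = blinfun_apply \<xi> x)"

definition locally_Lipschitz :: "('a::metric_space \<Rightarrow> real) \<Rightarrow> bool" where
  "locally_Lipschitz f \<longleftrightarrow> (\<forall>x. \<exists>r>0. \<exists>L. L-lipschitz_on (ball x r) f)"

text \<open>The upper limit is taken in the extended reals; it is finite when \<open>f\<close> is locally Lipschitz.
  As usual, \<open>y \<rightarrow> x\<close> allows \<open>y = x\<close>.\<close>

definition clarke_deriv :: "('a::real_normed_vector \<Rightarrow> real) \<Rightarrow> 'a \<Rightarrow> 'a \<Rightarrow> real" where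
  "clarke_deriv f x v =
     real_of_ereal (Limsup (nhds x \<times>\<^sub>F at_right (0::real))
       (\<lambda>(y, l). ereal ((f (y + l *\<^sub>R v) - f y) / l)))"

definition clarke_subdiff :: "('a::real_normed_vector \<Rightarrow> real) \<Rightarrow> 'a \<Rightarrow> ('a \<Rightarrow>\<^sub>L real) set" where
  "clarke_subdiff f x = {\<xi>. \<forall>v. clarke_deriv f x v \<ge> blinfun_apply \<xi> v}"

definition lsc_on :: "'a::topological_space set \<Rightarrow> ('a \<Rightarrow> real) \<Rightarrow> bool" where
  "lsc_on S f \<longleftrightarrow> (\<forall>x\<in>S. \<forall>a. a < f x \<longrightarrow> (\<forall>\<^sub>F y in at x within S. a < f y))"

text \<open>Derivatives are taken within \<open>S\<close>, i.e. they are one-sided at boundary points.  For the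
  closed quadrant used below they are uniquely determined.\<close>

definition C2_on :: "'a::real_normed_vector set \<Rightarrow> ('a \<Rightarrow> 'b::real_normed_vector) \<Rightarrow> bool" where
  "C2_on S f \<longleftrightarrow>
     (\<exists>(D1 :: 'a \<Rightarrow> 'a \<Rightarrow>\<^sub>L 'b) (D2 :: 'a \<Rightarrow> 'a \<Rightarrow>\<^sub>L 'a \<Rightarrow>\<^sub>L 'b).
        (\<forall>x\<in>S. (f has_derivative blinfun_apply (D1 x)) (at x within S)) \<and>
        (\<forall>x\<in>S. (D1 has_derivative blinfun_apply (D2 x)) (at x within S)) \<and>
        continuous_on S D2)"

text \<open>Vector-valued Lebesgue and Sobolev spaces on \<open>(0,T)\<close>.  The Bochner integral of the library
  requires a second countable range, which is not assumed here.  Hence strong measurability is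
  stated explicitly, and the vector-valued integrals are Henstock-Kurzweil integrals; these exist
  and agree with the Bochner integrals for strongly measurable, essentially bounded functions.\<close>

definition strongly_measurable :: "real \<Rightarrow> (real \<Rightarrow> 'a::real_normed_vector) \<Rightarrow> bool" where
  "strongly_measurable T g \<longleftrightarrow>
     (\<exists>s :: nat \<Rightarrow> real \<Rightarrow> 'a.
        (\<forall>i. simple_function (lebesgue_on {0<..<T}) (s i)) \<and>
        (AE t in lebesgue_on {0<..<T}. (\<lambda>i. s i t) \<longlonglongrightarrow> g t))"

definition Linf :: "real \<Rightarrow> (real \<Rightarrow> 'a::real_normed_vector) \<Rightarrow> bool" where
  "Linf T g \<longleftrightarrow> strongly_measurable T g \<and>
     (\<exists>M. AE t in lebesgue_on {0<..<T}. norm (g t) \<le> M)"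

definition test_function :: "real \<Rightarrow> (real \<Rightarrow> real) \<Rightarrow> bool" where
  "test_function T \<psi> \<longleftrightarrow>
     (\<forall>m x. (deriv ^^ m) \<psi> differentiable at x) \<and> closure {x. \<psi> x \<noteq> 0} \<subseteq> {0<..<T}"

definition weak_derivative ::
    "real \<Rightarrow> (real \<Rightarrow> 'a::real_normed_vector) \<Rightarrow> (real \<Rightarrow> 'a) \<Rightarrow> bool" where
  "weak_derivative T v g \<longleftrightarrow>
     (\<forall>\<psi>. test_function T \<psi> \<longrightarrow>
        (\<exists>I. ((\<lambda>t. deriv \<psi> t *\<^sub>R v t) has_integral I) {0..T} \<and>
             ((\<lambda>t. \<psi> t *\<^sub>R g t) has_integral - I) {0..T}))"

definition W2inf :: "real \<Rightarrow> (real \<Rightarrow> 'a::real_normed_vector) \<Rightarrow> bool" where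
  "W2inf T v \<longleftrightarrow>
     (\<exists>v' v''. Linf T v \<and> Linf T v' \<and> Linf T v'' \<and>
        weak_derivative T v v' \<and> weak_derivative T v' v'')"

definition W2inf_loc :: "(real \<Rightarrow> 'a::real_normed_vector) \<Rightarrow> bool" where
  "W2inf_loc v \<longleftrightarrow> (\<forall>T>0. W2inf T v)"

definition history_op ::
    "('a::banach \<Rightarrow>\<^sub>L 'y::real_normed_vector) \<Rightarrow> (real \<Rightarrow> real \<Rightarrow> 'a \<Rightarrow>\<^sub>L 'a) \<Rightarrow> 'a \<Rightarrow>
     (real \<Rightarrow> 'a) \<Rightarrow> real \<Rightarrow> 'y" where
  "history_op R q a v t = R (integral {0..t} (\<lambda>s. q t s (v s)) + a)"

definition history_discrete ::
    "('a::banach \<Rightarrow>\<^sub>L 'y::real_normed_vector) \<Rightarrow> (real \<Rightarrow> real \<Rightarrow> 'a \<Rightarrow>\<^sub>L 'a) \<Rightarrow> 'a \<Rightarrow>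
     real \<Rightarrow> nat \<Rightarrow> (nat \<Rightarrow> 'a) \<Rightarrow> 'y" where
  "history_discrete R q a k n v =
     (let t = (\<lambda>i::nat. real i * k) in
      if n = 0 then R a
      else R ((k / 2) *\<^sub>R q (t n) (t 0) (v 0)
              + k *\<^sub>R (\<Sum>i = 1..<n. q (t n) (t i) (v i))
              + (k / 2) *\<^sub>R q (t n) (t (n - 1)) (v (n - 1))
              + a))"

text \<open>In the two discrete problems, \<open>S\<close> stands for the value of the discrete history operator at
  the current step, \<open>fn\<close> for the current load and \<open>w\<close> for the unknown.\<close>

definition implicit_step ::
    "'x::real_normed_vector set \<Rightarrow> ('x \<Rightarrow> 'x \<Rightarrow>\<^sub>L real) \<Rightarrow> ('y \<Rightarrow> 'x \<Rightarrow> 'x \<Rightarrow> real) \<Rightarrow>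
     ('xj::real_normed_vector \<Rightarrow> real) \<Rightarrow> ('x \<Rightarrow>\<^sub>L 'xj) \<Rightarrow> 'y \<Rightarrow> ('x \<Rightarrow>\<^sub>L real) \<Rightarrow> 'x \<Rightarrow> bool" where
  "implicit_step K A \<phi> j \<gamma> S fn w \<longleftrightarrow>
     w \<in> K \<and>
     (\<forall>v\<in>K. A w (v - w) + \<phi> S w v - \<phi> S w w + clarke_deriv j (\<gamma> w) (\<gamma> v - \<gamma> w) \<ge> fn (v - w))"

text \<open>Here \<open>w1\<close> and \<open>w2\<close> are the one and two steps older iterates.  Since the second argument of
  \<open>\<phi>\<close> ranges over \<open>K\<close> only, the inequality is meaningful only if the extrapolated point
  \<open>2 w1 - w2\<close> belongs to \<open>K\<close>; this is part of what it means to satisfy it.\<close>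

definition extrapolated_step ::
    "'x::real_normed_vector set \<Rightarrow> ('x \<Rightarrow> 'x \<Rightarrow>\<^sub>L real) \<Rightarrow> ('y \<Rightarrow> 'x \<Rightarrow> 'x \<Rightarrow> real) \<Rightarrow>
     ('xj::real_normed_vector \<Rightarrow> real) \<Rightarrow> ('x \<Rightarrow>\<^sub>L 'xj) \<Rightarrow> ('xj \<Rightarrow> 'xj \<Rightarrow>\<^sub>L real) \<Rightarrow>
     'y \<Rightarrow> ('x \<Rightarrow>\<^sub>L real) \<Rightarrow> 'x \<Rightarrow> 'x \<Rightarrow> 'x \<Rightarrow> bool" where
  "extrapolated_step K A \<phi> j \<gamma> jc S fn w2 w1 w \<longleftrightarrow>
     w \<in> K \<and> 2 *\<^sub>R w1 - w2 \<in> K \<and>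
     (\<forall>v\<in>K. A w (v - w)
          + \<phi> S (2 *\<^sub>R w1 - w2) v - \<phi> S (2 *\<^sub>R w1 - w2) w
          + clarke_deriv j (\<gamma> w) (\<gamma> v - \<gamma> w)
          + jc (\<gamma> w) (\<gamma> v - \<gamma> w)
        \<ge> jc (2 *\<^sub>R \<gamma> w1 - \<gamma> w2) (\<gamma> v - \<gamma> w) + fn (v - w))"

end

theory Submission
  imports Defs
begin

text \<open>
Write \<open>e\<close> for the error at a time step and \<open>x\<close> for the extrapolated point \<open>2 w1 - w2\<close>.  Test the exact
inequality with the discrete solution, the discrete one with the exact solution, and add.  The loads
cancel, strong monotonicity of \<open>A\<close> leaves \<open>m (norm e)\<^sup>2\<close> on one side, and the nonconvex term costs at
most \<open>\<alpha>j (norm (\<gamma> e))\<^sup>2\<close>.  This cost does not enter the final estimate: the difference of the two \<open>jc\<close>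
terms equals \<open>jc (\<gamma> (u - x)) (\<gamma> e) - jc (\<gamma> e) (\<gamma> e)\<close>, whose second part pays for it by coercivity.
Hence (\<open>extrapolated_step_stability\<close>)

  \<open>m * norm e \<le> (\<alpha> + \<alpha>c * c\<^sup>2) * norm (u - x) + \<beta> * norm (S - S')\<close>.

Now \<open>u - x\<close> is a second difference of the exact solution plus twice the previous error minus the one
before it.  The weights \<open>2\<close> and \<open>1\<close> of the old errors add up to \<open>3\<close>, so the smallness condition with
the factor \<open>1/3\<close> says precisely that the old errors are damped.  The history term contributes the
quadrature error and \<open>k\<close> times the sum of all old errors.  If the second difference and the quadrature
error are of size \<open>k\<^sup>2\<close>, the recursion is solved by a geometric sequence with ratio \<open>1 + D k\<close>
(\<open>extrapolation_recursion_bound\<close>), which stays below \<open>exp (D T)\<close>.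

Both consistency errors measure how far a function is from its chords, and this is the only form in
which second order regularity is used: \<open>nearly_affine_on M S g\<close> bounds the distance of \<open>g\<close> from its
chord over an interval of length \<open>h\<close> by \<open>M h\<^sup>2\<close>.  With equal weights this is the bound on second
differences; integrated over a grid cell it is the error of the trapezoidal rule; and it passes to
products, so that it holds for \<open>s \<mapsto> q t s (u s)\<close> as soon as it holds for both factors.
For the kernel it follows from the mean value theorem.  For \<open>u\<close>, of which only bounded weak derivatives
are known, it is obtained by duality: the second derivative of a hat function is the combination of
point masses that evaluates the distance to the chord.  A smoothed hat is an admissible test function,
and integrating it against the bounded weak second derivative costs at most a multiple of \<open>h\<^sup>2\<close>.
\<close>

section \<open>Smooth mollifiers with explicit primitives\<close>

text \<open>The recursion through the derivative matches the way smoothness is inherited by sums, products and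
rescalings; the iterates of \<open>deriv\<close> in the definition of test functions do not combine as easily.\<close>

primrec times_differentiable :: "nat \<Rightarrow> (real \<Rightarrow> real) \<Rightarrow> bool" where
  "times_differentiable 0 f \<longleftrightarrow> True"
| "times_differentiable (Suc m) f \<longleftrightarrow>
     (\<forall>x. f differentiable at x) \<and> times_differentiable m (deriv f)"

lemma times_differentiable_iff:
  "times_differentiable m f \<longleftrightarrow> (\<forall>i<m. \<forall>x. (deriv ^^ i) f differentiable at x)"
proof (induction m arbitrary: f)
  case (Suc m)
  have "(deriv ^^ i) (deriv f) = (deriv ^^ Suc i) f" for i
    by (simp add: funpow_swap1)
  then show ?case
    by (auto simp: Suc.IH All_less_Suc2 simp del: funpow.simps)
qed simp

lemma times_differentiable_SucI:
  assumes "\<And>x. (f has_real_derivative f' x) (at x)" "times_differentiable m f'"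
  shows "times_differentiable (Suc m) f"
proof -
  have "deriv f = f'" using assms(1) by (auto intro: DERIV_imp_deriv)
  then show ?thesis using assms by (auto simp: real_differentiable_def)
qed

lemma times_differentiable_SucE:
  assumes "times_differentiable (Suc m) f"
  obtains f' where "\<And>x. (f has_real_derivative f' x) (at x)" "times_differentiable m f'"
  using assms by (intro that[of "deriv f"]) (auto simp: DERIV_deriv_iff_real_differentiable)

lemma times_differentiable_Suc_imp: "times_differentiable (Suc m) f \<Longrightarrow> times_differentiable m f"
  by (simp add: times_differentiable_iff del: times_differentiable.simps)

lemma times_differentiable_add:
  "times_differentiable m f \<Longrightarrow> times_differentiable m g \<Longrightarrow> times_differentiable m (\<lambda>x. f x + g x)"
proof (induction m arbitrary: f g)
  case (Suc m)
  obtain f' where f': "\<And>x. (f has_real_derivative f' x) (at x)" "times_differentiable m f'"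
    using Suc.prems(1) by (rule times_differentiable_SucE) (rule that)
  obtain g' where g': "\<And>x. (g has_real_derivative g' x) (at x)" "times_differentiable m g'"
    using Suc.prems(2) by (rule times_differentiable_SucE) (rule that)
  from f' g' show ?case
    by (intro times_differentiable_SucI[where f' = "\<lambda>x. f' x + g' x"] Suc.IH)
       (auto intro!: derivative_eq_intros)
qed simp

lemma times_differentiable_affine:
  "times_differentiable m f \<Longrightarrow> times_differentiable m (\<lambda>x. c * f (a * x + b))"
proof (induction m arbitrary: f c)
  case (Suc m)
  obtain f' where f':
    "\<And>x. (f has_real_derivative f' x) (at x)" "times_differentiable m f'"
    using Suc.prems by (rule times_differentiable_SucE) (rule that)
  have "((\<lambda>x. c * f (a * x + b)) has_real_derivative (c * a) * f' (a * x + b)) (at x)" for x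
  proof -
    have "((\<lambda>x. a * x + b) has_real_derivative a) (at x)"
      by (auto intro!: derivative_eq_intros)
    from DERIV_cmult[OF DERIV_chain2[OF f'(1) this], of c] show ?thesis
      by (simp add: mult_ac)
  qed
  then show ?case
    by (rule times_differentiable_SucI) (intro Suc.IH f')
qed simp

text \<open>The product rule turns one derivative of a product into a sum of two products of functions that are
differentiable once less often, so the induction closes together with the result on sums.\<close>

lemma times_differentiable_mult:
  "times_differentiable m f \<Longrightarrow> times_differentiable m g \<Longrightarrow> times_differentiable m (\<lambda>x. f x * g x)"
proof (induction m arbitrary: f g)
  case (Suc m)
  obtain f' where f': "\<And>x. (f has_real_derivative f' x) (at x)" "times_differentiable m f'"
    using Suc.prems(1) by (rule times_differentiable_SucE) (rule that)
  obtain g' where g': "\<And>x. (g has_real_derivative g' x) (at x)" "times_differentiable m g'"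
    using Suc.prems(2) by (rule times_differentiable_SucE) (rule that)
  have "((\<lambda>x. f x * g x) has_real_derivative f' x * g x + f x * g' x) (at x)" for x
    using f' g' by (auto intro!: derivative_eq_intros)
  then show ?case
    using f' g' times_differentiable_Suc_imp[OF Suc.prems(1)] times_differentiable_Suc_imp[OF Suc.prems(2)]
    by (intro times_differentiable_SucI[where f' = "\<lambda>x. f' x * g x + f x * g' x"]
          times_differentiable_add Suc.IH) auto
qed simp

text \<open>The classical function that is flat at the origin.  The negative powers in front of the exponential
are included because differentiation leads from one exponent to larger ones, so that the family is
closed under derivatives up to linear combinations.\<close>

definition flat_exp :: "nat \<Rightarrow> real \<Rightarrow> real" where
  "flat_exp p x = (if x \<le> 0 then 0 else inverse x ^ p * exp (- inverse x))"

lemma flat_exp_tendsto_0: "(flat_exp p \<longlongrightarrow> 0) (at 0)"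
proof -
  have "((\<lambda>x::real. inverse x ^ p / exp (inverse x)) \<longlongrightarrow> 0) (at_right 0)"
    by (rule filterlim_compose[OF tendsto_power_div_exp_0 filterlim_inverse_at_top_right])
  moreover have "\<forall>\<^sub>F x in at_right 0. inverse x ^ p / exp (inverse x) = flat_exp p x"
    unfolding eventually_at_right_field flat_exp_def
    by (intro exI[of _ 1]) (auto simp: field_simps exp_minus)
  ultimately have "(flat_exp p \<longlongrightarrow> 0) (at_right 0)"
    by (rule Lim_transform_eventually)
  moreover have "\<forall>\<^sub>F x in at_left 0. 0 = flat_exp p x"
    unfolding eventually_at_left_field flat_exp_def by (intro exI[of _ "-1"]) auto
  then have "(flat_exp p \<longlongrightarrow> 0) (at_left 0)"
    by (rule Lim_transform_eventually[OF tendsto_const])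
  ultimately show ?thesis by (simp add: filterlim_at_split)
qed

lemma flat_exp_has_derivative:
  "(flat_exp p has_real_derivative flat_exp (p + 2) x - real p * flat_exp (p + 1) x) (at x)"
proof (cases x "0::real" rule: linorder_cases)
  case less
  have "((\<lambda>x. 0) has_real_derivative 0) (at x)" by simp
  then have "(flat_exp p has_real_derivative 0) (at x)"
    by (rule has_field_derivative_transform_within_open[where S = "{..<0}"])
       (use less in \<open>auto simp: flat_exp_def\<close>)
  then show ?thesis using less by (simp add: flat_exp_def)
next
  case equal
  have "\<forall>\<^sub>F h in at 0. flat_exp (p + 1) h = (flat_exp p (0 + h) - flat_exp p 0) / h"
    unfolding eventually_at by (intro exI[of _ 1]) (auto simp: flat_exp_def field_simps)
  then have "((\<lambda>h. (flat_exp p (0 + h) - flat_exp p 0) / h) \<longlongrightarrow> 0) (at 0)"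
    by (rule Lim_transform_eventually[OF flat_exp_tendsto_0])
  then show ?thesis by (simp add: equal DERIV_def flat_exp_def)
next
  case greater
  have "((\<lambda>x. inverse x ^ p * exp (- inverse x)) has_real_derivative
          inverse x ^ (p + 2) * exp (- inverse x)
            - real p * (inverse x ^ (p + 1) * exp (- inverse x))) (at x)"
    using greater
    apply (cases p)
     apply (auto intro!: derivative_eq_intros simp: algebra_simps power2_eq_square)
    subgoal for n by (cases n) auto
    done
  then have "(flat_exp p has_real_derivative inverse x ^ (p + 2) * exp (- inverse x)
            - real p * (inverse x ^ (p + 1) * exp (- inverse x))) (at x)"
    by (rule has_field_derivative_transform_within_open[where S = "{0<..}"])
       (use greater in \<open>auto simp: flat_exp_def\<close>)
  then show ?thesis using greater by (simp add: flat_exp_def)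
qed

lemma times_differentiable_flat_exp: "times_differentiable m (flat_exp p)"
proof (induction m arbitrary: p)
  case (Suc m)
  have "times_differentiable m (\<lambda>x. flat_exp (p + 2) x + (- real p) * flat_exp (p + 1) (1 * x + 0))"
    by (intro times_differentiable_add times_differentiable_affine Suc.IH)
  moreover have "(flat_exp p has_real_derivative
      flat_exp (p + 2) x + (- real p) * flat_exp (p + 1) (1 * x + 0)) (at x)" for x
    using flat_exp_has_derivative[of p x] by simp
  ultimately show ?case by (metis (no_types, lifting) times_differentiable_SucI)
qed simp

text \<open>The lower limit of the integral lies strictly to the left of the support, so that every point is either
interior to an interval of integration or in the open region where the primitive is locally zero.\<close>

lemma primitive_vanishing_left:
  fixes f :: "real \<Rightarrow> real"
  assumes f: "continuous_on UNIV f" and z: "\<And>x. x \<le> -1 \<Longrightarrow> f x = 0"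
  obtains F where "\<And>x. (F has_real_derivative f x) (at x)" "\<And>x. x \<le> -1 \<Longrightarrow> F x = 0"
proof
  let ?F = "\<lambda>x. integral {-2..x} f"
  show F0: "?F x = 0" if "x \<le> -1" for x
    using that z by (subst integral_cong[of _ _ "\<lambda>_. 0"]) auto
  show "(?F has_real_derivative f x) (at x)" for x
  proof (cases "x < -1")
    case True
    have "((\<lambda>x. 0) has_real_derivative 0) (at x)" by simp
    then have "(?F has_real_derivative 0) (at x)"
      by (rule has_field_derivative_transform_within_open[where S = "{..<-1}"])
         (use True F0 in auto)
    then show ?thesis using True z by simp
  next
    case False
    have "(?F has_real_derivative f x) (at x within {-2..x+1})"
      using False by (intro integral_has_real_derivative continuous_on_subset[OF f]) auto
    then show ?thesis using False
      by (subst (asm) at_within_interior) auto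
  qed
qed

text \<open>A bump divided by its total mass, together with its first primitive \<open>E\<close>, a smoothed unit step, and its
second primitive \<open>H\<close>, a smoothed positive part.  The mass is the value at \<open>1\<close> of the primitive of
the bump and is positive by the mean value theorem.  The constant \<open>c\<close> is the first moment of the bump.\<close>

lemma unit_mollifier_exists:
  obtains H E \<eta> :: "real \<Rightarrow> real" and c :: real where
    "\<And>x. (H has_real_derivative E x) (at x)" "\<And>x. (E has_real_derivative \<eta> x) (at x)"
    "\<And>m. times_differentiable m \<eta>" "\<And>x. \<eta> x \<ge> 0"
    "\<And>x. x \<le> -1 \<Longrightarrow> E x = 0" "\<And>x. x \<le> -1 \<Longrightarrow> H x = 0"
    "\<And>x. x \<ge> 1 \<Longrightarrow> E x = 1" "\<And>x. x \<ge> 1 \<Longrightarrow> H x = x - c"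
    "\<And>x. \<bar>x\<bar> \<ge> 1 \<Longrightarrow> \<eta> x = 0"
proof -
  define \<beta> where "\<beta> x = (1 * flat_exp 0 (1 * x + 1)) * (1 * flat_exp 0 ((-1) * x + 1))" for x
  have \<beta>_diff: "times_differentiable m \<beta>" for m
    unfolding \<beta>_def
    by (intro times_differentiable_mult times_differentiable_affine times_differentiable_flat_exp)
  have \<beta>_cont: "continuous_on UNIV \<beta>"
    using \<beta>_diff[of 1]
    by (auto simp: continuous_on_eq_continuous_at intro: differentiable_imp_continuous_within)
  have \<beta>_out: "\<beta> x = 0" if "\<bar>x\<bar> \<ge> 1" for x
    using that by (auto simp: \<beta>_def flat_exp_def)
  have \<beta>_nonneg: "\<beta> x \<ge> 0" for x by (auto simp: \<beta>_def flat_exp_def)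
  have \<beta>_pos: "\<beta> x > 0" if "\<bar>x\<bar> < 1" for x using that by (auto simp: \<beta>_def flat_exp_def)
  obtain E where E: "\<And>x. (E has_real_derivative \<beta> x) (at x)" "\<And>x. x \<le> -1 \<Longrightarrow> E x = 0"
  proof (rule primitive_vanishing_left[OF \<beta>_cont])
    show "\<beta> x = 0" if "x \<le> -1" for x using that \<beta>_out[of x] by simp
  qed (rule that)
  obtain z where z: "z > -1" "z < 1" "E 1 - E (-1) = (1 - (-1)) * \<beta> z"
    using MVT2[of "-1" 1 E \<beta>] E(1) by auto
  have E1: "E 1 > 0" using z \<beta>_pos[of z] E(2)[of "-1"] by auto
  have E1': "E x = E 1" if x: "x \<ge> 1" for x
  proof (cases "x = 1")
    case False
    then obtain w where "w > 1" "w < x" "E x - E 1 = (x - 1) * \<beta> w"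
      using MVT2[of 1 x E \<beta>] E(1) x by auto
    then show ?thesis using \<beta>_out[of w] by simp
  qed simp
  let ?E = "\<lambda>x. E x / E 1"
  have E': "(?E has_real_derivative \<beta> x / E 1) (at x)" for x
    using DERIV_cdivide[OF E(1)] .
  have "continuous_on UNIV ?E"
    using E' by (intro DERIV_continuous_on[of _ _ "\<lambda>x. \<beta> x / E 1"]) auto
  then obtain H where H: "\<And>x. (H has_real_derivative ?E x) (at x)" "\<And>x. x \<le> -1 \<Longrightarrow> H x = 0"
  proof (rule primitive_vanishing_left[of ?E])
    show "E x / E 1 = 0" if "x \<le> -1" for x using E(2)[OF that] by simp
  qed (rule that)
  have H1: "H x = x - (1 - H 1)" if x: "x \<ge> 1" for x
  proof (cases "x = 1")
    case False
    then obtain w where "w > 1" "w < x" "H x - H 1 = (x - 1) * ?E w"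
      using MVT2[of 1 x H ?E] H(1) x by auto
    then show ?thesis using E1'[of w] E1 by simp
  qed simp
  have "times_differentiable m (\<lambda>x. \<beta> x / E 1)" for m
    using times_differentiable_affine[OF \<beta>_diff, of m "1 / E 1" 1 0] by simp
  note \<eta>_diff = this
  show ?thesis
  proof (rule that[of H ?E "\<lambda>x. \<beta> x / E 1" "1 - H 1"])
    show "E x / E 1 = 0" if "x \<le> -1" for x using E(2)[OF that] by simp
    show "E x / E 1 = 1" if "x \<ge> 1" for x using E1'[OF that] E1 by simp
    show "\<beta> x / E 1 \<ge> 0" for x using \<beta>_nonneg[of x] E1 by simp
    show "\<beta> x / E 1 = 0" if "\<bar>x\<bar> \<ge> 1" for x using \<beta>_out[OF that] by simp
  qed (fact H E' H1 \<eta>_diff)+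
qed

text \<open>Differences of translates of \<open>E\<close> are smoothed indicator functions, and suitable combinations of three
translates of \<open>H\<close> are smoothed hats.  These will serve as test functions.\<close>

locale mollifier =
  fixes \<epsilon> :: real and H E \<eta> :: "real \<Rightarrow> real" and c :: real
  assumes width: "\<epsilon> > 0"
    and H_deriv: "(H has_real_derivative E x) (at x)"
    and E_deriv: "(E has_real_derivative \<eta> x) (at x)"
    and \<eta>_smooth: "times_differentiable m \<eta>"
    and \<eta>_nonneg: "\<eta> x \<ge> 0"
    and E_left: "x \<le> -\<epsilon> \<Longrightarrow> E x = 0"
    and H_left: "x \<le> -\<epsilon> \<Longrightarrow> H x = 0"
    and E_right: "x \<ge> \<epsilon> \<Longrightarrow> E x = 1"
    and H_right: "x \<ge> \<epsilon> \<Longrightarrow> H x = x - c"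
    and \<eta>_outside: "\<bar>x\<bar> \<ge> \<epsilon> \<Longrightarrow> \<eta> x = 0"

lemma mollifier_exists:
  assumes "\<epsilon> > 0"
  obtains H E \<eta> c where "mollifier \<epsilon> H E \<eta> c"
proof -
  obtain H E \<eta> :: "real \<Rightarrow> real" and c :: real where *:
    "\<And>x. (H has_real_derivative E x) (at x)" "\<And>x. (E has_real_derivative \<eta> x) (at x)"
    "\<And>m. times_differentiable m \<eta>" "\<And>x. \<eta> x \<ge> 0"
    "\<And>x. x \<le> -1 \<Longrightarrow> E x = 0" "\<And>x. x \<le> -1 \<Longrightarrow> H x = 0"
    "\<And>x. x \<ge> 1 \<Longrightarrow> E x = 1" "\<And>x. x \<ge> 1 \<Longrightarrow> H x = x - c"
    "\<And>x. \<bar>x\<bar> \<ge> 1 \<Longrightarrow> \<eta> x = 0"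
    by (rule unit_mollifier_exists) (rule that)
  have scaling: "((\<lambda>x. x / \<epsilon>) has_real_derivative 1 / \<epsilon>) (at x)" for x
    using DERIV_cdivide[OF DERIV_ident] .
  have left: "x / \<epsilon> \<le> -1" if "x \<le> -\<epsilon>" for x using that assms by (simp add: field_simps)
  have right: "x / \<epsilon> \<ge> 1" if "x \<ge> \<epsilon>" for x using that assms by (simp add: field_simps)
  show ?thesis
  proof (rule that[of "\<lambda>x. \<epsilon> * H (x / \<epsilon>)" "\<lambda>x. E (x / \<epsilon>)" "\<lambda>x. \<eta> (x / \<epsilon>) / \<epsilon>" "\<epsilon> * c"],
      unfold_locales)
    show "((\<lambda>x. \<epsilon> * H (x / \<epsilon>)) has_real_derivative E (x / \<epsilon>)) (at x)" for x
      using DERIV_cmult[OF DERIV_chain2[OF *(1) scaling], of \<epsilon>] assms by simp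
    show "((\<lambda>x. E (x / \<epsilon>)) has_real_derivative \<eta> (x / \<epsilon>) / \<epsilon>) (at x)" for x
      using DERIV_chain2[OF *(2) scaling] by simp
    show "times_differentiable m (\<lambda>x. \<eta> (x / \<epsilon>) / \<epsilon>)" for m
      using times_differentiable_affine[OF *(3), of m "1 / \<epsilon>" "1 / \<epsilon>" 0] by simp
    show "\<epsilon> * H (x / \<epsilon>) = x - \<epsilon> * c" if "x \<ge> \<epsilon>" for x
      using *(8)[OF right[OF that]] assms by (simp add: right_diff_distrib)
    show "\<eta> (x / \<epsilon>) / \<epsilon> = 0" if "\<bar>x\<bar> \<ge> \<epsilon>" for x
      using *(9)[of "x / \<epsilon>"] that assms by (simp add: field_simps)
  qed (use * left right assms in auto)
qed

context mollifier begin

lemma E_smooth: "times_differentiable m E"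
  by (rule times_differentiable_Suc_imp) (rule times_differentiable_SucI[OF E_deriv \<eta>_smooth])

lemma H_smooth: "times_differentiable m H"
  by (rule times_differentiable_Suc_imp) (rule times_differentiable_SucI[OF H_deriv E_smooth])

lemma E_mono: "x \<le> y \<Longrightarrow> E x \<le> E y"
  using E_deriv \<eta>_nonneg by (intro DERIV_nonneg_imp_nondecreasing[of x y E]) blast+

lemma E_range: "0 \<le> E x" "E x \<le> 1"
  using E_mono[of "min x (-\<epsilon>)" x] E_mono[of x "max x \<epsilon>"] E_left[of "min x (-\<epsilon>)"] E_right[of "max x \<epsilon>"]
  by auto

lemma \<eta>_continuous: "continuous_on S (\<lambda>x. \<eta> (x - a))"
proof -
  have "continuous_on UNIV \<eta>"
    using \<eta>_smooth[of 1]
    by (auto simp: continuous_on_eq_continuous_at intro: differentiable_imp_continuous_within)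
  then show ?thesis
    by (rule continuous_on_compose2[where g = \<eta>]) (auto intro!: continuous_intros)
qed

text \<open>The weight has total mass one, which the fundamental theorem yields from the values of \<open>E\<close> at the end
points, so averaging against it changes a value by no more than the oscillation on the support.\<close>

lemma average_near_value:
  fixes u :: "real \<Rightarrow> 'a::banach"
  assumes u: "continuous_on {0..T} u" and a: "\<epsilon> \<le> a" "a + \<epsilon> \<le> T"
    and near: "\<And>x. x \<in> {0..T} \<Longrightarrow> \<bar>x - a\<bar> \<le> \<epsilon> \<Longrightarrow> norm (u x - u a) \<le> \<delta>"
  obtains J where "((\<lambda>x. \<eta> (x - a) *\<^sub>R u x) has_integral J) {0..T}" "norm (J - u a) \<le> \<delta>"
proof
  let ?J = "integral {0..T} (\<lambda>x. \<eta> (x - a) *\<^sub>R u x)"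
  have "(\<lambda>x. \<eta> (x - a) *\<^sub>R u x) integrable_on {0..T}"
    by (intro integrable_continuous_real continuous_on_scaleR \<eta>_continuous u)
  then show J: "((\<lambda>x. \<eta> (x - a) *\<^sub>R u x) has_integral ?J) {0..T}"
    by (rule integrable_integral)
  have "((\<lambda>x. \<eta> (x - a)) has_integral (E (T - a) - E (0 - a))) {0..T}"
  proof (rule fundamental_theorem_of_calculus)
    show "0 \<le> T" using a width by simp
    have "((\<lambda>x. E (x - a)) has_real_derivative \<eta> (x - a) * 1) (at x)" for x
      by (rule DERIV_chain2[OF E_deriv]) (auto intro!: derivative_eq_intros)
    then show "((\<lambda>x. E (x - a)) has_vector_derivative \<eta> (x - a)) (at x within {0..T})" for x
      by (simp add: has_real_derivative_iff_has_vector_derivative has_vector_derivative_at_within)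
  qed
  then have unit: "((\<lambda>x. \<eta> (x - a)) has_integral 1) {0..T}"
    using E_left[of "0 - a"] E_right[of "T - a"] a by simp
  have "((\<lambda>x. \<eta> (x - a) *\<^sub>R u x - \<eta> (x - a) *\<^sub>R u a) has_integral ?J - 1 *\<^sub>R u a) {0..T}"
    by (intro has_integral_diff J has_integral_scaleR_left unit)
  then have diff: "((\<lambda>x. \<eta> (x - a) *\<^sub>R (u x - u a)) has_integral ?J - u a) {0..T}"
    by (simp add: scaleR_diff_right)
  have "norm (integral {0..T} (\<lambda>x. \<eta> (x - a) *\<^sub>R (u x - u a)))
          \<le> integral {0..T} (\<lambda>x. \<eta> (x - a) * \<delta>)"
  proof (rule integral_norm_bound_integral)
    show "(\<lambda>x. \<eta> (x - a) *\<^sub>R (u x - u a)) integrable_on {0..T}" using diff by blast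
    show "(\<lambda>x. \<eta> (x - a) * \<delta>) integrable_on {0..T}"
      using has_integral_mult_left[OF unit] by blast
    show "norm (\<eta> (x - a) *\<^sub>R (u x - u a)) \<le> \<eta> (x - a) * \<delta>" if "x \<in> {0..T}" for x
    proof (cases "\<bar>x - a\<bar> \<le> \<epsilon>")
      case True
      then show ?thesis using near[OF that] \<eta>_nonneg[of "x - a"] by (simp add: mult_left_mono)
    next
      case False
      then show ?thesis using \<eta>_outside[of "x - a"] by simp
    qed
  qed
  then show "norm (?J - u a) \<le> \<delta>"
    using integral_unique[OF diff] integral_unique[OF unit] by simp
qed

end

section \<open>Functions close to their chords\<close>

text \<open>For twice differentiable functions the smallest such \<open>M\<close> is comparable to the bound on the second
derivative; the condition itself refers to no derivative.\<close>

definition nearly_affine_on :: "real \<Rightarrow> real set \<Rightarrow> (real \<Rightarrow> 'a::real_normed_vector) \<Rightarrow> bool" where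
  "nearly_affine_on M S g \<longleftrightarrow>
     (\<forall>a\<in>S. \<forall>b\<in>S. \<forall>\<theta>\<in>{0..1}.
        norm (g ((1 - \<theta>) * a + \<theta> * b) - ((1 - \<theta>) *\<^sub>R g a + \<theta> *\<^sub>R g b)) \<le> M * (b - a)\<^sup>2)"

lemma nearly_affine_onI:
  assumes "\<And>a b \<theta>. a \<in> S \<Longrightarrow> b \<in> S \<Longrightarrow> a \<le> b \<Longrightarrow> 0 \<le> \<theta> \<Longrightarrow> \<theta> \<le> 1 \<Longrightarrow>
      norm (g ((1 - \<theta>) * a + \<theta> * b) - ((1 - \<theta>) *\<^sub>R g a + \<theta> *\<^sub>R g b)) \<le> M * (b - a)\<^sup>2"
  shows "nearly_affine_on M S g"
  unfolding nearly_affine_on_def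
proof (intro ballI)
  fix a b \<theta> :: real assume *: "a \<in> S" "b \<in> S" "\<theta> \<in> {0..1}"
  show "norm (g ((1 - \<theta>) * a + \<theta> * b) - ((1 - \<theta>) *\<^sub>R g a + \<theta> *\<^sub>R g b)) \<le> M * (b - a)\<^sup>2"
  proof (cases "a \<le> b")
    case True then show ?thesis using assms[of a b \<theta>] * by auto
  next
    case False then show ?thesis
      using assms[of b a "1 - \<theta>"] * by (simp add: add.commute power2_commute[of a b])
  qed
qed

lemma nearly_affine_onD:
  "nearly_affine_on M S g \<Longrightarrow> a \<in> S \<Longrightarrow> b \<in> S \<Longrightarrow> 0 \<le> \<theta> \<Longrightarrow> \<theta> \<le> 1 \<Longrightarrow>
    norm (g ((1 - \<theta>) * a + \<theta> * b) - ((1 - \<theta>) *\<^sub>R g a + \<theta> *\<^sub>R g b)) \<le> M * (b - a)\<^sup>2"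
  by (auto simp: nearly_affine_on_def)

lemma nearly_affine_on_subset: "nearly_affine_on M S g \<Longrightarrow> S' \<subseteq> S \<Longrightarrow> nearly_affine_on M S' g"
  unfolding nearly_affine_on_def by blast

lemma convex_combination_between:
  fixes a b \<theta> :: real
  assumes "a \<le> b" "0 \<le> \<theta>" "\<theta> \<le> 1"
  shows "a \<le> (1 - \<theta>) * a + \<theta> * b" "(1 - \<theta>) * a + \<theta> * b \<le> b"
proof -
  have "(1 - \<theta>) * a + \<theta> * b = a + \<theta> * (b - a)" by (simp add: algebra_simps)
  then show "a \<le> (1 - \<theta>) * a + \<theta> * b" using assms by simp
  have "(1 - \<theta>) * a + \<theta> * b = b - (1 - \<theta>) * (b - a)" by (simp add: algebra_simps)
  moreover have "0 \<le> (1 - \<theta>) * (b - a)" using assms by simp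
  ultimately show "(1 - \<theta>) * a + \<theta> * b \<le> b" by linarith
qed

section \<open>Regularity from bounded weak derivatives\<close>

text \<open>The two end points, about which the measure on the open interval says nothing, are added to the
exceptional set.\<close>

lemma AE_on_interval_negligible:
  fixes T :: real
  assumes "AE t in lebesgue_on {0<..<T}. P t"
  obtains N where "negligible N" "\<And>t. t \<in> {0..T} - N \<Longrightarrow> P t"
proof -
  have "AE t in lebesgue. t \<in> {0<..<T} \<longrightarrow> P t"
    using assms by (subst (asm) AE_restrict_space_iff) simp_all
  then obtain N where N: "{t \<in> space lebesgue. \<not> (t \<in> {0<..<T} \<longrightarrow> P t)} \<subseteq> N"
    "emeasure lebesgue N = 0" "N \<in> sets lebesgue"
    by (rule AE_E)
  then have "negligible N" by (simp add: negligible_iff_null_sets null_sets_def)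
  then have "negligible (N \<union> {0, T})" by (rule negligible_Un) (simp add: negligible_finite)
  moreover have "P t" if "t \<in> {0..T} - (N \<union> {0, T})" for t
    using N(1) that by (force simp: subset_iff less_le)
  ultimately show ?thesis by (rule that)
qed

lemma weak_pairing_bound:
  fixes g :: "real \<Rightarrow> 'a::banach"
  assumes I: "((\<lambda>t. \<psi> t *\<^sub>R g t) has_integral I) {0..T}"
    and g: "AE t in lebesgue_on {0<..<T}. norm (g t) \<le> M"
    and supp: "{c..d} \<subseteq> {0..T}" "c \<le> d" "\<And>t. t \<notin> {c..d} \<Longrightarrow> \<psi> t = 0"
    and B: "\<And>t. \<bar>\<psi> t\<bar> \<le> B"
  shows "norm I \<le> B * \<bar>M\<bar> * (d - c)"
proof -
  obtain N where N: "negligible N" "\<And>t. t \<in> {0..T} - N \<Longrightarrow> norm (g t) \<le> M"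
    using g by (rule AE_on_interval_negligible) (rule that)
  let ?h = "\<lambda>t. if t \<in> N then 0 else \<psi> t *\<^sub>R g t"
  let ?k = "\<lambda>t. if t \<in> {c..d} then B * \<bar>M\<bar> else 0"
  have h: "(?h has_integral I) {0..T}"
    by (rule has_integral_spike[OF N(1) _ I]) auto
  have "((\<lambda>t. B * \<bar>M\<bar>) has_integral B * \<bar>M\<bar> * (d - c)) {c..d}"
    using has_integral_const_real[of "B * \<bar>M\<bar>" c d] supp(2) by (simp add: mult.commute)
  then have k: "(?k has_integral B * \<bar>M\<bar> * (d - c)) {0..T}"
    by (subst has_integral_restrict[OF supp(1)])
  have B0: "0 \<le> B" using B[of 0] by linarith
  have "norm (integral {0..T} ?h) \<le> integral {0..T} ?k"
  proof (rule integral_norm_bound_integral)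
    show "?h integrable_on {0..T}" "?k integrable_on {0..T}" using h k by blast+
    fix t assume t: "t \<in> {0..T}"
    show "norm (?h t) \<le> ?k t"
    proof (cases "t \<in> N \<or> t \<notin> {c..d}")
      case True
      then show ?thesis using supp(3)[of t] B0 by auto
    next
      case False
      then have "norm (g t) \<le> \<bar>M\<bar>" using N(2)[of t] t by auto
      then show ?thesis using False B[of t] B0 by (auto intro!: mult_mono)
    qed
  qed
  then show ?thesis using h k by (simp add: integral_unique)
qed

lemma test_functionI:
  assumes "\<And>m. times_differentiable m \<psi>" "\<And>x. x \<notin> {c..d} \<Longrightarrow> \<psi> x = 0" "0 < c" "d < T"
  shows "test_function T \<psi>"
  unfolding test_function_def
proof
  show "\<forall>m x. (deriv ^^ m) \<psi> differentiable at x"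
    using assms(1) by (auto simp: times_differentiable_iff simp del: times_differentiable.simps)
  have "closure {x. \<psi> x \<noteq> 0} \<subseteq> {c..d}"
    using assms(2) by (intro closure_minimal) (auto simp del: atLeastAtMost_iff)
  then show "closure {x. \<psi> x \<noteq> 0} \<subseteq> {0<..<T}"
    using assms(3,4) by force
qed

lemma times_differentiable_shift:
  "times_differentiable m f \<Longrightarrow> times_differentiable m (\<lambda>x. c * f (x - a))"
  using times_differentiable_affine[of m f c 1 "- a"] by simp

lemma DERIV_scaled_shift:
  assumes "\<And>x::real. (f has_real_derivative f' x) (at x)"
  shows "((\<lambda>x. c * f (x - a)) has_real_derivative c * f' (x - a)) (at x)"
proof -
  have "((\<lambda>x. x - a) has_real_derivative 1) (at x)" by (auto intro!: derivative_eq_intros)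
  from DERIV_cmult[OF DERIV_chain2[OF assms this], of c] show ?thesis by simp
qed

lemma uniformly_near_on_interval:
  fixes u :: "real \<Rightarrow> 'a::real_normed_vector"
  assumes "continuous_on {0..T} u" "\<delta> > 0"
  obtains \<rho> where "\<rho> > 0"
    "\<And>x y. x \<in> {0..T} \<Longrightarrow> y \<in> {0..T} \<Longrightarrow> \<bar>x - y\<bar> < \<rho> \<Longrightarrow> norm (u x - u y) \<le> \<delta>"
proof -
  have "uniformly_continuous_on {0..T} u"
    using assms(1) by (simp add: compact_uniformly_continuous)
  then obtain \<rho> where \<rho>: "\<rho> > 0"
    "\<And>x y. x \<in> {0..T} \<Longrightarrow> y \<in> {0..T} \<Longrightarrow> dist y x < \<rho> \<Longrightarrow> dist (u y) (u x) < \<delta>"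
    unfolding uniformly_continuous_on_def using assms(2) by metis
  have "norm (u x - u y) \<le> \<delta>" if "x \<in> {0..T}" "y \<in> {0..T}" "\<bar>x - y\<bar> < \<rho>" for x y
    using \<rho>(2)[OF that(2,1)] that(3) by (simp add: dist_norm)
  then show ?thesis using \<rho>(1) by (intro that)
qed

lemma norm_diff_diff_le: "norm (x - y - z) \<le> norm x + norm y + norm z"
  for x y z :: "'a::real_normed_vector"
  using norm_triangle_ineq4[of "x - y" z] norm_triangle_ineq4[of x y] by linarith

text \<open>Removes the smoothing parameter from the estimates below.\<close>

lemma le_if_le_add_multiple:
  fixes x y C :: real
  assumes "\<And>\<delta>. \<delta> > 0 \<Longrightarrow> x \<le> y + C * \<delta>"
  shows "x \<le> y"
proof (rule field_le_epsilon)
  fix e :: real assume e: "e > 0"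
  have "C * (e / (\<bar>C\<bar> + 1)) \<le> (\<bar>C\<bar> + 1) * (e / (\<bar>C\<bar> + 1))"
    using e by (intro mult_right_mono) auto
  then show "x \<le> y + e" using assms[of "e / (\<bar>C\<bar> + 1)"] e by simp
qed

text \<open>Tested with a smoothed indicator function of \<open>{a..b}\<close>, the weak derivative produces on one side averages
of \<open>u\<close> around \<open>a\<close> and \<open>b\<close> with opposite signs, and on the other an integral over essentially
\<open>{a..b}\<close> of a function bounded by \<open>M\<close>.\<close>

lemma weak_derivative_bounded_imp_Lipschitz:
  fixes u v :: "real \<Rightarrow> 'a::banach"
  assumes weak: "weak_derivative T u v" and v: "AE t in lebesgue_on {0<..<T}. norm (v t) \<le> M"
    and u: "continuous_on {0..T} u" and ab: "0 < a" "a \<le> b" "b < T"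
  shows "norm (u b - u a) \<le> \<bar>M\<bar> * (b - a)"
proof (rule le_if_le_add_multiple)
  fix \<delta> :: real assume \<delta>: "\<delta> > 0"
  obtain \<rho> where \<rho>: "\<rho> > 0"
    "\<And>x y. x \<in> {0..T} \<Longrightarrow> y \<in> {0..T} \<Longrightarrow> \<bar>x - y\<bar> < \<rho> \<Longrightarrow> norm (u x - u y) \<le> \<delta>"
    using uniformly_near_on_interval[OF u \<delta>] by metis
  define \<epsilon> where "\<epsilon> = min (min \<delta> (\<rho> / 2)) (min (a / 2) ((T - b) / 2))"
  have \<epsilon>: "\<epsilon> > 0" "\<epsilon> \<le> \<delta>" "\<epsilon> < \<rho>" "\<epsilon> < a" "b + \<epsilon> < T"
    using \<delta> \<rho>(1) ab by (auto simp: \<epsilon>_def min_def field_simps)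
  obtain H E \<eta> c where "mollifier \<epsilon> H E \<eta> c" using mollifier_exists[OF \<epsilon>(1)] by metis
  then interpret mollifier \<epsilon> H E \<eta> c .
  have near: "norm (u x - u y) \<le> \<delta>" if "x \<in> {0..T}" "\<bar>x - y\<bar> \<le> \<epsilon>" "y \<in> {a..b}" for x y
    using that \<rho>(2)[of x y] \<epsilon> ab by auto
  define \<psi> where "\<psi> x = 1 * E (x - a) + (-1) * E (x - b)" for x
  have \<psi>': "(\<psi> has_real_derivative 1 * \<eta> (x - a) + (-1) * \<eta> (x - b)) (at x)" for x
    unfolding \<psi>_def by (intro DERIV_add DERIV_scaled_shift E_deriv)
  have zero: "\<psi> x = 0" if "x \<notin> {a - \<epsilon>..b + \<epsilon>}" for x
  proof (cases "x < a - \<epsilon>")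
    case True then show ?thesis using ab by (simp add: \<psi>_def E_left)
  next
    case False then show ?thesis using that ab by (simp add: \<psi>_def E_right)
  qed
  have "test_function T \<psi>"
  proof (rule test_functionI[where c = "a - \<epsilon>" and d = "b + \<epsilon>"])
    show "times_differentiable m \<psi>" for m
      unfolding \<psi>_def by (intro times_differentiable_add times_differentiable_shift E_smooth)
  qed (use \<epsilon> zero in auto)
  then obtain I where I: "((\<lambda>t. deriv \<psi> t *\<^sub>R u t) has_integral I) {0..T}"
      "((\<lambda>t. \<psi> t *\<^sub>R v t) has_integral - I) {0..T}"
    using weak unfolding weak_derivative_def by blast
  have bound: "\<bar>\<psi> x\<bar> \<le> 1" for x
    using E_range[of "x - a"] E_range[of "x - b"] by (simp add: \<psi>_def)
  have "norm (- I) \<le> 1 * \<bar>M\<bar> * (b + \<epsilon> - (a - \<epsilon>))"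
    by (rule weak_pairing_bound[OF I(2) v _ _ zero bound]) (use \<epsilon> ab in auto)
  then have I_le: "norm I \<le> \<bar>M\<bar> * (b - a) + \<bar>M\<bar> * (2 * \<epsilon>)" by (simp add: algebra_simps)
  obtain Ja where Ja: "((\<lambda>x. \<eta> (x - a) *\<^sub>R u x) has_integral Ja) {0..T}" "norm (Ja - u a) \<le> \<delta>"
    by (rule average_near_value[OF u, of a \<delta>]) (use \<epsilon> ab near in auto)
  obtain Jb where Jb: "((\<lambda>x. \<eta> (x - b) *\<^sub>R u x) has_integral Jb) {0..T}" "norm (Jb - u b) \<le> \<delta>"
    by (rule average_near_value[OF u, of b \<delta>]) (use \<epsilon> ab near in auto)
  have "((\<lambda>x. deriv \<psi> x *\<^sub>R u x) has_integral Ja - Jb) {0..T}"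
    using has_integral_diff[OF Ja(1) Jb(1)] by (simp add: DERIV_imp_deriv[OF \<psi>'] scaleR_diff_left)
  then have "I = Ja - Jb" using I(1) has_integral_unique by blast
  then have "norm (u b - u a) = norm ((Ja - u a) - (Jb - u b) - I)" by simp
  also have "\<dots> \<le> norm (Ja - u a) + norm (Jb - u b) + norm I"
    by (rule norm_diff_diff_le)
  also have "\<dots> \<le> \<delta> + \<delta> + (\<bar>M\<bar> * (b - a) + \<bar>M\<bar> * (2 * \<delta>))"
    using Ja(2) Jb(2) I_le mult_left_mono[OF \<epsilon>(2), of "\<bar>M\<bar>"] by linarith
  finally show "norm (u b - u a) \<le> \<bar>M\<bar> * (b - a) + (2 + 2 * \<bar>M\<bar>) * \<delta>"
    by (simp add: algebra_simps)
qed

text \<open>The same argument with a smoothed hat that is affine between \<open>a\<close>, \<open>m\<close> and \<open>b\<close>.  Its second derivative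
averages \<open>u\<close> around the three points with the weights \<open>1 - \<theta>\<close>, \<open>- 1\<close> and \<open>\<theta>\<close>.  The hat has slope at
most one and therefore height at most its width, which gives the quadratic bound.\<close>

lemma weak_second_derivative_bounded_imp_nearly_affine:
  fixes u v w :: "real \<Rightarrow> 'a::banach"
  assumes weak: "weak_derivative T u v" "weak_derivative T v w"
    and w: "AE t in lebesgue_on {0<..<T}. norm (w t) \<le> M"
    and u: "continuous_on {0..T} u" and ab: "0 < a" "a \<le> b" "b < T" and \<theta>: "0 \<le> \<theta>" "\<theta> \<le> 1"
  shows "norm (u ((1 - \<theta>) * a + \<theta> * b) - ((1 - \<theta>) *\<^sub>R u a + \<theta> *\<^sub>R u b)) \<le> \<bar>M\<bar> * (b - a)\<^sup>2"
proof (rule le_if_le_add_multiple)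
  fix \<delta> :: real assume \<delta>: "\<delta> > 0"
  define m where "m = (1 - \<theta>) * a + \<theta> * b"
  have m: "a \<le> m" "m \<le> b"
    unfolding m_def using convex_combination_between[OF ab(2) \<theta>] by auto
  obtain \<rho> where \<rho>: "\<rho> > 0"
    "\<And>x y. x \<in> {0..T} \<Longrightarrow> y \<in> {0..T} \<Longrightarrow> \<bar>x - y\<bar> < \<rho> \<Longrightarrow> norm (u x - u y) \<le> \<delta>"
    using uniformly_near_on_interval[OF u \<delta>] by metis
  define \<epsilon> where "\<epsilon> = min (min (min 1 \<delta>) (\<rho> / 2)) (min (a / 2) ((T - b) / 2))"
  have \<epsilon>: "\<epsilon> > 0" "\<epsilon> \<le> \<delta>" "\<epsilon> \<le> 1" "\<epsilon> < \<rho>" "\<epsilon> < a" "b + \<epsilon> < T"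
    using \<delta> \<rho>(1) ab by (auto simp: \<epsilon>_def min_def field_simps)
  obtain H E \<eta> c where "mollifier \<epsilon> H E \<eta> c" using mollifier_exists[OF \<epsilon>(1)] by metis
  then interpret mollifier \<epsilon> H E \<eta> c .
  have near: "norm (u x - u y) \<le> \<delta>" if "x \<in> {0..T}" "\<bar>x - y\<bar> \<le> \<epsilon>" "y \<in> {a..b}" for x y
    using that \<rho>(2)[of x y] \<epsilon> ab by auto
  \<comment> \<open>Applied to \<open>\<eta>\<close>, \<open>E\<close> and \<open>H\<close> in turn this gives the smoothed point masses, the slope and the hat itself.\<close>
  define comb :: "(real \<Rightarrow> real) \<Rightarrow> real \<Rightarrow> real"
    where "comb F x = ((1 - \<theta>) * F (x - a) + \<theta> * F (x - b)) + (-1) * F (x - m)" for F x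
  have comb_deriv: "(comb F has_real_derivative comb F' x) (at x)"
    if "\<And>x. (F has_real_derivative F' x) (at x)" for F F' x
    unfolding comb_def by (intro DERIV_add DERIV_scaled_shift that)
  have comb_smooth: "times_differentiable n (comb F)" if "times_differentiable n F" for n F
    unfolding comb_def by (intro times_differentiable_add times_differentiable_shift that)
  \<comment> \<open>To the right of the support the weights make both the slopes and the affine functions cancel; the first moment \<open>c\<close> drops out because the weights sum to zero.\<close>
  have zero: "comb E x = 0 \<and> comb H x = 0" if "x \<notin> {a - \<epsilon>..b + \<epsilon>}" for x
  proof (cases "x < a - \<epsilon>")
    case True then show ?thesis using ab m by (simp add: comb_def E_left H_left)
  next
    case False
    then have "x - a \<ge> \<epsilon>" "x - b \<ge> \<epsilon>" "x - m \<ge> \<epsilon>" using that ab m by auto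
    then show ?thesis by (simp add: comb_def E_right H_right) (simp add: m_def algebra_simps)
  qed
  have test: "test_function T (comb E)" "test_function T (comb H)"
    by (rule test_functionI[of _ "a - \<epsilon>" "b + \<epsilon>"];
        use comb_smooth E_smooth H_smooth zero \<epsilon> in auto)+
  obtain I where I: "((\<lambda>t. deriv (comb E) t *\<^sub>R u t) has_integral I) {0..T}"
      "((\<lambda>t. comb E t *\<^sub>R v t) has_integral - I) {0..T}"
    using weak(1) test(1) unfolding weak_derivative_def by blast
  obtain I' where I': "((\<lambda>t. deriv (comb H) t *\<^sub>R v t) has_integral I') {0..T}"
      "((\<lambda>t. comb H t *\<^sub>R w t) has_integral - I') {0..T}"
    using weak(2) test(2) unfolding weak_derivative_def by blast
  have "I' = - I"
    using I(2) I'(1) has_integral_unique by (simp add: DERIV_imp_deriv[OF comb_deriv[OF H_deriv]]) blast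
  then have Iw: "((\<lambda>t. comb H t *\<^sub>R w t) has_integral I) {0..T}" using I'(2) by simp
  \<comment> \<open>A convex combination of values in \<open>{0..1}\<close> minus such a value.\<close>
  have slope: "\<bar>comb E x\<bar> \<le> 1" for x
  proof -
    have "(1 - \<theta>) * E (x - a) + \<theta> * E (x - b) \<le> 1"
      using E_range[of "x - a"] E_range[of "x - b"] \<theta> by (intro convex_bound_le) auto
    moreover have "0 \<le> (1 - \<theta>) * E (x - a) + \<theta> * E (x - b)"
      using E_range[of "x - a"] E_range[of "x - b"] \<theta> by auto
    ultimately show ?thesis using E_range[of "x - m"] by (simp add: comb_def)
  qed
  have bound: "\<bar>comb H x\<bar> \<le> b - a + 2 * \<epsilon>" for x
  proof (cases "x \<in> {a - \<epsilon><..b + \<epsilon>}")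
    case True
    then obtain z where "comb H x - comb H (a - \<epsilon>) = (x - (a - \<epsilon>)) * comb E z"
      using MVT2[of "a - \<epsilon>" x "comb H" "comb E"] comb_deriv[OF H_deriv] by auto
    moreover have "comb H (a - \<epsilon>) = 0" using ab m by (simp add: comb_def H_left)
    ultimately have "\<bar>comb H x\<bar> = (x - (a - \<epsilon>)) * \<bar>comb E z\<bar>" using True by (simp add: abs_mult)
    also have "\<dots> \<le> (x - (a - \<epsilon>)) * 1" using True slope by (intro mult_left_mono) auto
    finally show ?thesis using True by simp
  next
    case False
    then have "comb H x = 0"
      using zero[of x] ab m by (cases "x = a - \<epsilon>") (auto simp: comb_def H_left)
    then show ?thesis using ab \<epsilon> by simp
  qed
  have "norm I \<le> (b - a + 2 * \<epsilon>) * \<bar>M\<bar> * (b + \<epsilon> - (a - \<epsilon>))"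
    by (rule weak_pairing_bound[OF Iw w _ _ _ bound]) (use \<epsilon> ab zero in auto)
  then have I_le: "norm I \<le> \<bar>M\<bar> * (b - a + 2 * \<epsilon>)\<^sup>2" by (simp add: algebra_simps power2_eq_square)
  have "(b - a + 2 * \<epsilon>)\<^sup>2 \<le> (b - a)\<^sup>2 + (4 * T + 4) * \<delta>"
  proof -
    have "(b - a + 2 * \<epsilon>)\<^sup>2 = (b - a)\<^sup>2 + 4 * ((b - a) * \<epsilon>) + 4 * (\<epsilon> * \<epsilon>)"
      by (simp add: power2_eq_square algebra_simps)
    moreover have "(b - a) * \<epsilon> \<le> T * \<delta>" using ab \<epsilon> by (intro mult_mono) auto
    moreover have "\<epsilon> * \<epsilon> \<le> 1 * \<delta>" using \<epsilon> by (intro mult_mono) auto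
    ultimately show ?thesis by (simp add: algebra_simps)
  qed
  from order_trans[OF I_le mult_left_mono[OF this abs_ge_zero[of M]]]
  have I_le': "norm I \<le> \<bar>M\<bar> * (b - a)\<^sup>2 + \<bar>M\<bar> * (4 * T + 4) * \<delta>" by (simp add: algebra_simps)
  obtain Ja where Ja: "((\<lambda>x. \<eta> (x - a) *\<^sub>R u x) has_integral Ja) {0..T}" "norm (Ja - u a) \<le> \<delta>"
    by (rule average_near_value[OF u, of a \<delta>]) (use \<epsilon> ab near in auto)
  obtain Jb where Jb: "((\<lambda>x. \<eta> (x - b) *\<^sub>R u x) has_integral Jb) {0..T}" "norm (Jb - u b) \<le> \<delta>"
    by (rule average_near_value[OF u, of b \<delta>]) (use \<epsilon> ab near in auto)
  obtain Jm where Jm: "((\<lambda>x. \<eta> (x - m) *\<^sub>R u x) has_integral Jm) {0..T}" "norm (Jm - u m) \<le> \<delta>"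
    by (rule average_near_value[OF u, of m \<delta>]) (use \<epsilon> ab m near in auto)
  have "((\<lambda>x. (1 - \<theta>) *\<^sub>R (\<eta> (x - a) *\<^sub>R u x) + \<theta> *\<^sub>R (\<eta> (x - b) *\<^sub>R u x) - \<eta> (x - m) *\<^sub>R u x)
          has_integral (1 - \<theta>) *\<^sub>R Ja + \<theta> *\<^sub>R Jb - Jm) {0..T}"
    by (intro has_integral_diff has_integral_add has_integral_cmul Ja Jb Jm)
  moreover have weights: "(1 - \<theta>) *\<^sub>R (\<eta> (x - a) *\<^sub>R u x) + \<theta> *\<^sub>R (\<eta> (x - b) *\<^sub>R u x) - \<eta> (x - m) *\<^sub>R u x
      = deriv (comb E) x *\<^sub>R u x" for x
    by (simp add: DERIV_imp_deriv[OF comb_deriv[OF E_deriv]] comb_def scaleR_add_left scaleR_diff_left)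
  ultimately have "((\<lambda>x. deriv (comb E) x *\<^sub>R u x)
      has_integral (1 - \<theta>) *\<^sub>R Ja + \<theta> *\<^sub>R Jb - Jm) {0..T}"
    by (simp only: weights)
  then have "I = (1 - \<theta>) *\<^sub>R Ja + \<theta> *\<^sub>R Jb - Jm" using I(1) has_integral_unique by blast
  then have "u m - ((1 - \<theta>) *\<^sub>R u a + \<theta> *\<^sub>R u b)
      = ((1 - \<theta>) *\<^sub>R (Ja - u a) + \<theta> *\<^sub>R (Jb - u b)) - (Jm - u m) - I"
    by (simp add: algebra_simps)
  then have "norm (u m - ((1 - \<theta>) *\<^sub>R u a + \<theta> *\<^sub>R u b))
      \<le> norm ((1 - \<theta>) *\<^sub>R (Ja - u a) + \<theta> *\<^sub>R (Jb - u b)) + norm (Jm - u m) + norm I"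
    by (simp only: norm_diff_diff_le)
  also have "norm ((1 - \<theta>) *\<^sub>R (Ja - u a) + \<theta> *\<^sub>R (Jb - u b)) \<le> \<delta>"
  proof -
    have "norm ((1 - \<theta>) *\<^sub>R (Ja - u a) + \<theta> *\<^sub>R (Jb - u b))
        \<le> (1 - \<theta>) * norm (Ja - u a) + \<theta> * norm (Jb - u b)"
      using norm_triangle_ineq[of "(1 - \<theta>) *\<^sub>R (Ja - u a)" "\<theta> *\<^sub>R (Jb - u b)"] \<theta> by simp
    also have "\<dots> \<le> \<delta>" using Ja(2) Jb(2) \<theta> by (intro convex_bound_le) auto
    finally show ?thesis .
  qed
  finally have "norm (u m - ((1 - \<theta>) *\<^sub>R u a + \<theta> *\<^sub>R u b))
      \<le> \<delta> + \<delta> + (\<bar>M\<bar> * (b - a)\<^sup>2 + \<bar>M\<bar> * (4 * T + 4) * \<delta>)"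
    using Jm(2) I_le' by linarith
  then show "norm (u ((1 - \<theta>) * a + \<theta> * b) - ((1 - \<theta>) *\<^sub>R u a + \<theta> *\<^sub>R u b))
      \<le> \<bar>M\<bar> * (b - a)\<^sup>2 + (2 + \<bar>M\<bar> * (4 * T + 4)) * \<delta>"
    by (simp add: m_def algebra_simps)
qed

text \<open>The two previous estimates hold for interior points only.  The right end point is covered by working on
a larger interval, the left one by translating all points by \<open>h\<close> and letting \<open>h\<close> tend to \<open>0\<close>.\<close>

lemma W2inf_loc_imp_Lipschitz_nearly_affine:
  fixes u :: "real \<Rightarrow> 'a::banach"
  assumes reg: "W2inf_loc u" and u: "continuous_on {0..} u" and T: "T > 0"
  obtains M where "M \<ge> 0" "M-lipschitz_on {0..T} u" "nearly_affine_on M {0..T} u"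
      "\<And>s. s \<in> {0..T} \<Longrightarrow> norm (u s) \<le> M"
proof -
  obtain v w where vw: "Linf (T + 1) v" "Linf (T + 1) w"
      "weak_derivative (T + 1) u v" "weak_derivative (T + 1) v w"
    using reg T unfolding W2inf_loc_def W2inf_def by (metis add_pos_pos zero_less_one)
  obtain M1 where M1: "AE t in lebesgue_on {0<..<T+1}. norm (v t) \<le> M1"
    using vw(1) unfolding Linf_def by blast
  obtain M2 where M2: "AE t in lebesgue_on {0<..<T+1}. norm (w t) \<le> M2"
    using vw(2) unfolding Linf_def by blast
  have u': "continuous_on {0..T+1} u" by (rule continuous_on_subset[OF u]) auto
  have "bounded (u ` {0..T})"
    by (intro compact_imp_bounded compact_continuous_image continuous_on_subset[OF u]) auto
  then obtain M0 where M0: "\<And>s. s \<in> {0..T} \<Longrightarrow> norm (u s) \<le> M0"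
    unfolding bounded_iff by blast
  let ?M = "\<bar>M0\<bar> + \<bar>M1\<bar> + \<bar>M2\<bar>"
  have shift: "((\<lambda>h. u (x + h)) \<longlongrightarrow> u x) (at_right 0)" if "x \<ge> 0" for x
  proof -
    have "(u \<longlongrightarrow> u x) (at x within {0..})" using u that by (simp add: continuous_on)
    moreover have "filterlim (\<lambda>h. x + h) (at x within {0..}) (at_right 0)"
      unfolding filterlim_at using that
      by (auto intro!: tendsto_eq_intros simp: eventually_at_right_field intro: exI[of _ 1])
    ultimately show ?thesis by (rule filterlim_compose)
  qed
  have small: "\<forall>\<^sub>F h in at_right (0::real). 0 < h \<and> h < 1"
    by (auto simp: eventually_at_right_field intro: exI[of _ 1])
  have Lip: "norm (u b - u a) \<le> ?M * (b - a)" if ab: "0 \<le> a" "a \<le> b" "b \<le> T" for a b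
  proof (rule tendsto_upperbound)
    show "((\<lambda>h. norm (u (b + h) - u (a + h))) \<longlongrightarrow> norm (u b - u a)) (at_right 0)"
      using ab by (intro tendsto_intros shift) auto
    show "\<forall>\<^sub>F h in at_right 0. norm (u (b + h) - u (a + h)) \<le> ?M * (b - a)"
      using small
    proof eventually_elim
      case (elim h)
      have "norm (u (b + h) - u (a + h)) \<le> \<bar>M1\<bar> * (b + h - (a + h))"
        by (rule weak_derivative_bounded_imp_Lipschitz[OF vw(3) M1 u']) (use elim ab in auto)
      also have "\<dots> \<le> ?M * (b - a)" using ab by (simp add: mult_right_mono)
      finally show ?case .
    qed
  qed simp
  show ?thesis
  proof (rule that)
    show "norm (u s) \<le> ?M" if "s \<in> {0..T}" for s using M0[OF that] by simp
    show "?M-lipschitz_on {0..T} u"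
    proof (rule lipschitz_onI)
      fix x y assume "x \<in> {0..T}" "y \<in> {0..T}"
      then show "dist (u x) (u y) \<le> ?M * dist x y"
        using Lip[of x y] Lip[of y x]
        by (cases "x \<le> y") (auto simp: dist_norm norm_minus_commute)
    qed simp
    show "nearly_affine_on ?M {0..T} u"
    proof (rule nearly_affine_onI)
      fix a b \<theta> :: real assume ab: "a \<in> {0..T}" "b \<in> {0..T}" "a \<le> b" and \<theta>: "0 \<le> \<theta>" "\<theta> \<le> 1"
      let ?m = "(1 - \<theta>) * a + \<theta> * b"
      show "norm (u ?m - ((1 - \<theta>) *\<^sub>R u a + \<theta> *\<^sub>R u b)) \<le> ?M * (b - a)\<^sup>2"
      proof (rule tendsto_upperbound)
        show "((\<lambda>h. norm (u (?m + h) - ((1 - \<theta>) *\<^sub>R u (a + h) + \<theta> *\<^sub>R u (b + h))))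
            \<longlongrightarrow> norm (u ?m - ((1 - \<theta>) *\<^sub>R u a + \<theta> *\<^sub>R u b))) (at_right 0)"
          using ab \<theta> by (intro tendsto_intros shift) auto
        show "\<forall>\<^sub>F h in at_right 0. norm (u (?m + h) - ((1 - \<theta>) *\<^sub>R u (a + h) + \<theta> *\<^sub>R u (b + h)))
            \<le> ?M * (b - a)\<^sup>2"
          using small
        proof eventually_elim
          case (elim h)
          have m: "(1 - \<theta>) * (a + h) + \<theta> * (b + h) = ?m + h" by (simp add: algebra_simps)
          have "norm (u ((1 - \<theta>) * (a + h) + \<theta> * (b + h))
              - ((1 - \<theta>) *\<^sub>R u (a + h) + \<theta> *\<^sub>R u (b + h))) \<le> \<bar>M2\<bar> * (b + h - (a + h))\<^sup>2"
            by (rule weak_second_derivative_bounded_imp_nearly_affine[OF vw(3,4) M2 u'])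
               (use elim ab \<theta> in auto)
          also have "\<dots> \<le> ?M * (b - a)\<^sup>2" by (simp add: mult_right_mono)
          finally show ?case unfolding m .
        qed
      qed simp
    qed
  qed simp
qed

section \<open>Quadrature and the history operator\<close>

text \<open>Subtracting the affine function with slope \<open>g' a\<close> does not change the distance to chords, and what
remains has a derivative of size at most \<open>B (b - a)\<close> on the interval.\<close>

lemma Lipschitz_derivative_imp_nearly_affine:
  fixes g g' :: "real \<Rightarrow> 'a::real_normed_vector"
  assumes deriv: "\<And>s. s \<in> {0..T} \<Longrightarrow> (g has_vector_derivative g' s) (at s within {0..T})"
    and Lip: "B-lipschitz_on {0..T} g'"
  shows "nearly_affine_on (2 * B) {0..T} g"
proof (rule nearly_affine_onI)
  fix a b \<theta> :: real assume ab: "a \<in> {0..T}" "b \<in> {0..T}" "a \<le> b" and \<theta>: "0 \<le> \<theta>" "\<theta> \<le> 1"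
  let ?m = "(1 - \<theta>) * a + \<theta> * b"
  \<comment> \<open>The tangent direction at \<open>a\<close> is removed.\<close>
  define h where "h x = g x - x *\<^sub>R g' a" for x
  have B: "B \<ge> 0" using Lip by (rule lipschitz_on_nonneg)
  have h': "(h has_derivative (\<lambda>d. d *\<^sub>R (g' x - g' a))) (at x within {a..b})" if "x \<in> {a..b}" for x
  proof -
    have "(g has_derivative (\<lambda>d. d *\<^sub>R g' x)) (at x within {a..b})"
      using has_vector_derivative_within_subset[OF deriv[of x], of "{a..b}"] that ab
      by (auto simp: has_vector_derivative_def)
    then show ?thesis unfolding h_def
      by (auto intro!: derivative_eq_intros simp: scaleR_diff_right)
  qed
  have slope: "onorm (\<lambda>d::real. d *\<^sub>R (g' x - g' a)) \<le> B * (b - a)" if "x \<in> {a..b}" for x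
  proof (rule onorm_bound)
    have "norm (g' x - g' a) \<le> B * \<bar>x - a\<bar>"
      using lipschitz_onD[OF Lip, of x a] that ab by (simp add: dist_norm)
    also have "\<dots> \<le> B * (b - a)" using that B by (intro mult_left_mono) auto
    finally have "norm (g' x - g' a) \<le> B * (b - a)" .
    from mult_left_mono[OF this, of "\<bar>d\<bar>" for d]
    show "norm (d *\<^sub>R (g' x - g' a)) \<le> B * (b - a) * norm d" for d :: real
      by (simp add: mult.commute)
  qed (use B ab in auto)
  have h_le: "norm (h x - h a) \<le> B * (b - a)\<^sup>2" if x: "x \<in> {a..b}" for x
  proof -
    have "norm (h x - h a) \<le> B * (b - a) * norm (x - a)"
      by (rule differentiable_bound[OF _ h' slope]) (use x ab in auto)
    also have "\<dots> \<le> B * (b - a) * (b - a)" using x B ab by (intro mult_left_mono) auto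
    finally show ?thesis by (simp add: power2_eq_square mult.assoc)
  qed
  have "g ?m - ((1 - \<theta>) *\<^sub>R g a + \<theta> *\<^sub>R g b) = (h ?m - h a) - \<theta> *\<^sub>R (h b - h a)"
    by (simp add: h_def algebra_simps)
  also have "norm \<dots> \<le> norm (h ?m - h a) + \<theta> * norm (h b - h a)"
    using norm_triangle_ineq4[of "h ?m - h a" "\<theta> *\<^sub>R (h b - h a)"] \<theta> by simp
  also have "\<dots> \<le> B * (b - a)\<^sup>2 + 1 * (B * (b - a)\<^sup>2)"
    using convex_combination_between[OF ab(3) \<theta>] ab \<theta> B by (intro add_mono mult_mono h_le) auto
  finally show "norm (g ?m - ((1 - \<theta>) *\<^sub>R g a + \<theta> *\<^sub>R g b)) \<le> 2 * B * (b - a)\<^sup>2" by simp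
qed

text \<open>The product of the two chords is not the chord of the product; the two differ by
\<open>\<theta> (1 - \<theta>) (q b - q a) (u b - u a)\<close>, which is quadratically small because both factors are
Lipschitz continuous.\<close>

lemma nearly_affine_on_blinfun_apply:
  fixes q :: "real \<Rightarrow> 'a::real_normed_vector \<Rightarrow>\<^sub>L 'b::real_normed_vector"
  assumes q: "B-lipschitz_on {0..T} q" "nearly_affine_on B {0..T} q" "\<And>s. s \<in> {0..T} \<Longrightarrow> norm (q s) \<le> B"
    and u: "U-lipschitz_on {0..T} u" "nearly_affine_on U {0..T} u" "\<And>s. s \<in> {0..T} \<Longrightarrow> norm (u s) \<le> U"
  shows "nearly_affine_on (3 * (B * U)) {0..T} (\<lambda>s. q s (u s))"
proof (rule nearly_affine_onI)
  fix a b \<theta> :: real assume ab: "a \<in> {0..T}" "b \<in> {0..T}" "a \<le> b" and \<theta>: "0 \<le> \<theta>" "\<theta> \<le> 1"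
  let ?m = "(1 - \<theta>) * a + \<theta> * b"
  let ?q = "(1 - \<theta>) *\<^sub>R q a + \<theta> *\<^sub>R q b" and ?u = "(1 - \<theta>) *\<^sub>R u a + \<theta> *\<^sub>R u b"
  have m: "?m \<in> {0..T}" using convex_combination_between[OF ab(3) \<theta>] ab by auto
  have B: "B \<ge> 0" and U: "U \<ge> 0" using q(1) u(1) by (auto dest: lipschitz_on_nonneg)
  have split: "q ?m (u ?m) - ((1 - \<theta>) *\<^sub>R q a (u a) + \<theta> *\<^sub>R q b (u b))
      = q ?m (u ?m - ?u) + (q ?m - ?q) ?u - (\<theta> * (1 - \<theta>)) *\<^sub>R (q b - q a) (u b - u a)"
    by (simp add: blinfun.bilinear_simps algebra_simps)
  have "norm (q ?m (u ?m - ?u)) \<le> B * (U * (b - a)\<^sup>2)"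
    by (rule order_trans[OF norm_blinfun mult_mono])
       (use q(3)[OF m] nearly_affine_onD[OF u(2) ab(1,2) \<theta>] B in auto)
  moreover have "norm ((q ?m - ?q) ?u) \<le> (B * (b - a)\<^sup>2) * U"
  proof (rule order_trans[OF norm_blinfun mult_mono])
    have "norm ?u \<le> (1 - \<theta>) * norm (u a) + \<theta> * norm (u b)"
      using norm_triangle_ineq[of "(1 - \<theta>) *\<^sub>R u a" "\<theta> *\<^sub>R u b"] \<theta> by simp
    also have "\<dots> \<le> U" using u(3) ab \<theta> by (intro convex_bound_le) auto
    finally show "norm ?u \<le> U" .
  qed (use nearly_affine_onD[OF q(2) ab(1,2) \<theta>] B in auto)
  moreover have "norm ((\<theta> * (1 - \<theta>)) *\<^sub>R (q b - q a) (u b - u a)) \<le> (B * (b - a)) * (U * (b - a))"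
  proof -
    have "norm ((\<theta> * (1 - \<theta>)) *\<^sub>R (q b - q a) (u b - u a)) \<le> 1 * norm ((q b - q a) (u b - u a))"
      using \<theta> mult_right_mono[OF mult_le_one[of \<theta> "1 - \<theta>"], of "norm ((q b - q a) (u b - u a))"]
      by (simp add: abs_mult)
    also have "\<dots> \<le> norm (q b - q a) * norm (u b - u a)" by (simp add: norm_blinfun)
    also have "\<dots> \<le> (B * (b - a)) * (U * (b - a))"
      using lipschitz_onD[OF q(1) ab(2,1)] lipschitz_onD[OF u(1) ab(2,1)] ab B
      by (intro mult_mono) (auto simp: dist_norm)
    finally show ?thesis .
  qed
  ultimately have "norm (q ?m (u ?m) - ((1 - \<theta>) *\<^sub>R q a (u a) + \<theta> *\<^sub>R q b (u b)))
      \<le> B * (U * (b - a)\<^sup>2) + (B * (b - a)\<^sup>2) * U + (B * (b - a)) * (U * (b - a))"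
    unfolding split
    using norm_triangle_ineq4[of "q ?m (u ?m - ?u) + (q ?m - ?q) ?u"
        "(\<theta> * (1 - \<theta>)) *\<^sub>R (q b - q a) (u b - u a)"]
      norm_triangle_ineq[of "q ?m (u ?m - ?u)" "(q ?m - ?q) ?u"] by linarith
  also have "\<dots> = 3 * (B * U) * (b - a)\<^sup>2" by (simp add: power2_eq_square algebra_simps)
  finally show "norm (q ?m (u ?m) - ((1 - \<theta>) *\<^sub>R q a (u a) + \<theta> *\<^sub>R q b (u b)))
      \<le> 3 * (B * U) * (b - a)\<^sup>2" .
qed

lemma lipschitz_on_blinfun_apply:
  fixes q :: "real \<Rightarrow> 'a::real_normed_vector \<Rightarrow>\<^sub>L 'b::real_normed_vector"
  assumes q: "B-lipschitz_on S q" "\<And>s. s \<in> S \<Longrightarrow> norm (q s) \<le> B"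
    and u: "U-lipschitz_on S u" "\<And>s. s \<in> S \<Longrightarrow> norm (u s) \<le> U"
  shows "(2 * (B * U))-lipschitz_on S (\<lambda>s. q s (u s))"
proof (rule lipschitz_onI)
  have B: "B \<ge> 0" and U: "U \<ge> 0" using q(1) u(1) by (auto dest: lipschitz_on_nonneg)
  then show "0 \<le> 2 * (B * U)" by simp
  fix x y assume xy: "x \<in> S" "y \<in> S"
  have "q x (u x) - q y (u y) = q x (u x - u y) + (q x - q y) (u y)"
    by (simp add: blinfun.bilinear_simps)
  also have "norm \<dots> \<le> norm (q x) * norm (u x - u y) + norm (q x - q y) * norm (u y)"
    by (rule order_trans[OF norm_triangle_ineq add_mono[OF norm_blinfun norm_blinfun]])
  also have "\<dots> \<le> B * (U * dist x y) + (B * dist x y) * U"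
    using xy q(2) u(2) lipschitz_onD[OF q(1) xy] lipschitz_onD[OF u(1) xy] B U
    by (intro add_mono mult_mono) (auto simp: dist_norm)
  finally show "dist (q x (u x)) (q y (u y)) \<le> 2 * (B * U) * dist x y"
    by (simp add: dist_norm algebra_simps)
qed

text \<open>The trapezoidal rule integrates the chord exactly, so its error is the integral of the distance to the
chord.\<close>

lemma trapezoidal_rule_error:
  fixes g :: "real \<Rightarrow> 'a::banach"
  assumes g: "continuous_on {a..b} g" "nearly_affine_on M {a..b} g" and ab: "a < b"
  shows "norm (integral {a..b} g - ((b - a) / 2) *\<^sub>R (g a + g b)) \<le> M * (b - a) ^ 3"
proof -
  define p where "p x = g a + ((x - a) / (b - a)) *\<^sub>R (g b - g a)" for x
  define P where "P x = x *\<^sub>R g a + ((x - a)\<^sup>2 / (2 * (b - a))) *\<^sub>R (g b - g a)" for x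
  have P': "(P has_vector_derivative p x) (at x within {a..b})" for x
  proof -
    have sq: "((\<lambda>x. (x - a)\<^sup>2 / (2 * (b - a))) has_real_derivative (x - a) / (b - a)) (at x within {a..b})"
    proof -
      have "((\<lambda>x. (x - a)\<^sup>2) has_real_derivative 2 * (x - a)) (at x within {a..b})"
        by (auto intro!: derivative_eq_intros)
      from DERIV_cdivide[OF this, of "2 * (b - a)"] show ?thesis
        by (simp only: mult_divide_mult_cancel_left[of 2] zero_neq_numeral[symmetric] not_False_eq_True)
    qed
    show ?thesis
      using has_vector_derivative_add[OF has_vector_derivative_scaleR[OF DERIV_ident has_vector_derivative_const]
          has_vector_derivative_scaleR[OF sq has_vector_derivative_const], of "g a" "g b - g a"]
      by (simp add: P_def[abs_def] p_def)
  qed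
  have "(p has_integral P b - P a) {a..b}"
    using ab P' by (intro fundamental_theorem_of_calculus) auto
  moreover have "P b - P a = ((b - a) / 2) *\<^sub>R (g a + g b)"
  proof -
    have "h\<^sup>2 / (2 * h) = h / 2" for h :: real by (simp add: power2_eq_square)
    from this[of "b - a"] have "(b - a)\<^sup>2 / (2 * (b - a)) = (b - a) / 2" .
    then have "P b - P a = b *\<^sub>R g a + ((b - a) / 2) *\<^sub>R (g b - g a) - a *\<^sub>R g a"
      unfolding P_def by (simp only: diff_self power2_eq_square) simp
    then have "P b - P a = (b - a) *\<^sub>R g a + ((b - a) / 2) *\<^sub>R (g b - g a)"
      by (simp add: scaleR_diff_left)
    also have "\<dots> = ((b - a) / 2) *\<^sub>R (2 *\<^sub>R g a + (g b - g a))"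
      by (simp add: scaleR_add_right)
    finally show ?thesis by (simp add: scaleR_2 algebra_simps)
  qed
  ultimately have "((\<lambda>x. g x - p x) has_integral integral {a..b} g - ((b - a) / 2) *\<^sub>R (g a + g b)) {a..b}"
    using g(1) by (intro has_integral_diff integrable_integral integrable_continuous_real) auto
  moreover have "norm (g x - p x) \<le> M * (b - a)\<^sup>2" if "x \<in> cbox a b" for x
  proof -
    define \<theta> where "\<theta> = (x - a) / (b - a)"
    have \<theta>: "0 \<le> \<theta>" "\<theta> \<le> 1" using that ab by (auto simp: \<theta>_def)
    \<comment> \<open>The integrand at \<open>x\<close> is the distance to the chord at the parameter \<open>\<theta>\<close>.\<close>
    have "\<theta> * (b - a) = x - a" using ab by (simp add: \<theta>_def)
    then have "(1 - \<theta>) * a + \<theta> * b = x" by (simp add: algebra_simps)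
    moreover have "p x = (1 - \<theta>) *\<^sub>R g a + \<theta> *\<^sub>R g b" by (simp add: p_def \<theta>_def algebra_simps)
    ultimately show ?thesis using nearly_affine_onD[OF g(2), of a b \<theta>] \<theta> ab by simp
  qed
  moreover have "0 \<le> M * (b - a)\<^sup>2"
    using order_trans[OF norm_ge_zero nearly_affine_onD[OF g(2), of a b 0]] ab by simp
  ultimately have "norm (integral {a..b} g - ((b - a) / 2) *\<^sub>R (g a + g b))
      \<le> M * (b - a)\<^sup>2 * measure lborel (cbox a b)"
    by (intro has_integral_bound) auto
  then show ?thesis using ab by (simp add: power3_eq_cube power2_eq_square mult.assoc)
qed

lemma composite_trapezoidal_rule_error:
  fixes g :: "real \<Rightarrow> 'a::banach"
  assumes g: "continuous_on {0..T} g" "nearly_affine_on M {0..T} g" and k: "k > 0" "real n * k \<le> T"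
  shows "norm (integral {0..real n * k} g
      - (\<Sum>i<n. (k / 2) *\<^sub>R (g (real i * k) + g (real (Suc i) * k)))) \<le> real n * (M * k ^ 3)"
  using k(2)
proof (induction n)
  case (Suc n)
  let ?a = "real n * k" and ?b = "real (Suc n) * k"
  let ?S = "\<Sum>i<n. (k / 2) *\<^sub>R (g (real i * k) + g (real (Suc i) * k))"
  have ab: "0 \<le> ?a" "?a < ?b" "?b \<le> T" "?b - ?a = k" using k(1) Suc.prems by (auto simp: algebra_simps)
  have "g integrable_on {0..?b}"
    using ab by (intro integrable_continuous_real continuous_on_subset[OF g(1)]) auto
  then have "integral {0..?b} g = integral {0..?a} g + integral {?a..?b} g"
    using ab Henstock_Kurzweil_Integration.integral_combine[where a = 0 and c = ?a and b = ?b and f = g] by simp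
  then have "integral {0..?b} g - (?S + (k / 2) *\<^sub>R (g ?a + g ?b))
      = (integral {0..?a} g - ?S) + (integral {?a..?b} g - ((?b - ?a) / 2) *\<^sub>R (g ?a + g ?b))"
    using ab(4) by simp
  also have "norm \<dots> \<le> real n * (M * k ^ 3) + M * (?b - ?a) ^ 3"
  proof (rule norm_triangle_le[OF add_mono])
    show "norm (integral {0..?a} g - ?S) \<le> real n * (M * k ^ 3)" using Suc.IH ab by linarith
    show "norm (integral {?a..?b} g - ((?b - ?a) / 2) *\<^sub>R (g ?a + g ?b)) \<le> M * (?b - ?a) ^ 3"
      using ab by (intro trapezoidal_rule_error continuous_on_subset[OF g(1)]
          nearly_affine_on_subset[OF g(2)]) auto
  qed
  also have "\<dots> = real (Suc n) * (M * k ^ 3)" using ab(4) by (simp add: algebra_simps)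
  finally show ?case by simp
qed simp

lemma trapezoidal_sum_weights:
  fixes G :: "nat \<Rightarrow> 'a::real_vector"
  shows "(\<Sum>i<Suc n. (k / 2) *\<^sub>R (G i + G (Suc i)))
     = (k / 2) *\<^sub>R G 0 + k *\<^sub>R (\<Sum>i = 1..<Suc n. G i) + (k / 2) *\<^sub>R G (Suc n)"
proof (induction n)
  case (Suc n)
  have "k *\<^sub>R G (Suc n) = (k / 2) *\<^sub>R G (Suc n) + (k / 2) *\<^sub>R G (Suc n)"
    by (simp flip: scaleR_add_left)
  moreover have "(\<Sum>i = 1..<Suc (Suc n). G i) = (\<Sum>i = 1..<Suc n. G i) + G (Suc n)"
    by (rule sum.atLeastLessThan_Suc) simp
  ultimately show ?case
    unfolding sum.lessThan_Suc[of _ "Suc n"] Suc.IH by (simp only: scaleR_add_right add_ac)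
qed (simp add: scaleR_add_right)

text \<open>The discrete operator is the composite trapezoidal rule, except that at the right end point the unknown
current value is replaced by the previous one.  That replacement carries the weight \<open>k / 2\<close> and changes
a Lipschitz continuous integrand over a distance \<open>k\<close>, so it is of the same order \<open>k\<^sup>2\<close> as the
quadrature error.  It is also what confines the sum of errors to indices below \<open>n\<close>.\<close>

lemma history_error:
  fixes R :: "'x::banach \<Rightarrow>\<^sub>L 'y::real_normed_vector"
  assumes q: "\<And>t. t \<in> {0..T} \<Longrightarrow> B-lipschitz_on {0..T} (q t)"
      "\<And>t. t \<in> {0..T} \<Longrightarrow> nearly_affine_on B {0..T} (q t)"
      "\<And>t s. t \<in> {0..T} \<Longrightarrow> s \<in> {0..T} \<Longrightarrow> norm (q t s) \<le> B"
    and u: "U-lipschitz_on {0..T} u" "nearly_affine_on U {0..T} u" "\<And>s. s \<in> {0..T} \<Longrightarrow> norm (u s) \<le> U"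
    and k: "k > 0" "real n * k \<le> T"
  shows "norm (history_op R q a u (real n * k) - history_discrete R q a k n v)
     \<le> norm R * ((3 * T + 1) * (B * U) * k\<^sup>2 + 2 * B * k * (\<Sum>i<n. norm (u (real i * k) - v i)))"
proof (cases n)
  case 0
  have "U \<ge> 0" "T \<ge> 0" "B \<ge> 0" using u(1) q(1)[of 0] k 0 by (auto dest: lipschitz_on_nonneg)
  then show ?thesis using 0 by (simp add: history_op_def history_discrete_def)
next
  case (Suc n')
  let ?t = "real n * k"
  define g where "g s = q ?t s (u s)" for s
  define Q where "Q i = q ?t (real i * k)" for i
  define e where "e i = norm (u (real i * k) - v i)" for i
  have t: "?t \<in> {0..T}" using k by simp
  have BU: "B \<ge> 0" "U \<ge> 0" using q(1)[OF t] u(1) by (auto dest: lipschitz_on_nonneg)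
  have T: "T \<ge> 0" using t by simp
  have grid: "real i * k \<in> {0..T}" if "i \<le> n" for i
  proof -
    have "real i * k \<le> T"
      using that k(1) by (intro order_trans[OF mult_right_mono k(2)]) auto
    then show ?thesis using k by simp
  qed
  have g_affine: "nearly_affine_on (3 * (B * U)) {0..T} g"
    unfolding g_def by (intro nearly_affine_on_blinfun_apply q t u)
  have g_Lip: "(2 * (B * U))-lipschitz_on {0..T} g"
    unfolding g_def by (intro lipschitz_on_blinfun_apply q t u)
  define G where "G i = g (real i * k)" for i :: nat
  define D where "D i = G i - Q i (v i)" for i
  have D: "norm (D i) \<le> B * e i" if "i \<le> n" for i
  proof -
    have "D i = Q i (u (real i * k) - v i)"
      by (simp add: D_def G_def g_def Q_def blinfun.bilinear_simps)
    also have "norm \<dots> \<le> norm (Q i) * e i" unfolding e_def by (rule norm_blinfun)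
    also have "\<dots> \<le> B * e i"
      using q(3)[OF t grid[OF that]] by (intro mult_right_mono) (auto simp: Q_def e_def)
    finally show ?thesis .
  qed
  define S where "S = (\<Sum>i<n. (k / 2) *\<^sub>R (G i + G (Suc i)))"
  have S: "S = (k / 2) *\<^sub>R G 0 + k *\<^sub>R (\<Sum>i = 1..<n. G i) + (k / 2) *\<^sub>R G n"
    unfolding S_def Suc by (rule trapezoidal_sum_weights)
  have quad: "norm (integral {0..?t} g - S) \<le> 3 * T * (B * U) * k\<^sup>2"
  proof -
    have "norm (integral {0..?t} g - S) \<le> real n * (3 * (B * U) * k ^ 3)"
      unfolding S_def G_def
      by (rule composite_trapezoidal_rule_error[OF lipschitz_on_continuous_on[OF g_Lip] g_affine k])
    also have "\<dots> = (real n * k) * (3 * (B * U) * k\<^sup>2)" by (simp add: power3_eq_cube power2_eq_square)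
    also have "\<dots> \<le> T * (3 * (B * U) * k\<^sup>2)" using k BU by (intro mult_right_mono) auto
    finally show ?thesis by (simp add: mult_ac)
  qed
  define W where "W = (k / 2) *\<^sub>R Q 0 (v 0) + k *\<^sub>R (\<Sum>i = 1..<n. Q i (v i)) + (k / 2) *\<^sub>R Q (n - 1) (v (n - 1))"
  have "S - W = (k / 2) *\<^sub>R (G n - G (n - 1))
      + ((k / 2) *\<^sub>R D 0 + k *\<^sub>R (\<Sum>i = 1..<n. D i) + (k / 2) *\<^sub>R D (n - 1))"
    unfolding S W_def D_def by (simp add: sum_subtractf scaleR_diff_right)
  moreover have "norm ((k / 2) *\<^sub>R (G n - G (n - 1))) \<le> (B * U) * k\<^sup>2"
  proof -
    have "norm (G n - G (n - 1)) \<le> 2 * (B * U) * \<bar>real n * k - real (n - 1) * k\<bar>"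
      using lipschitz_onD[OF g_Lip grid[of n] grid[of "n - 1"]] by (simp add: G_def dist_norm)
    also have "real n * k - real (n - 1) * k = k" by (simp add: Suc algebra_simps)
    finally have "norm (G n - G (n - 1)) \<le> 2 * (B * U) * k" using k by simp
    from mult_left_mono[OF this, of "k / 2"] show ?thesis
      using k by (simp add: power2_eq_square mult_ac)
  qed
  moreover have "norm ((k / 2) *\<^sub>R D 0 + k *\<^sub>R (\<Sum>i = 1..<n. D i) + (k / 2) *\<^sub>R D (n - 1))
      \<le> 2 * B * k * (\<Sum>i<n. e i)"
  proof -
    have e0: "e i \<ge> 0" for i by (simp add: e_def)
    have single: "e i \<le> (\<Sum>i<n. e i)" if "i < n" for i
      using that e0 by (intro member_le_sum) auto
    have "norm (\<Sum>i = 1..<n. D i) \<le> (\<Sum>i = 1..<n. B * e i)" by (intro sum_norm_le D) auto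
    also have "\<dots> \<le> (\<Sum>i<n. B * e i)" using BU e0 by (intro sum_mono2) auto
    finally have mid: "norm (\<Sum>i = 1..<n. D i) \<le> B * (\<Sum>i<n. e i)" by (simp add: sum_distrib_left)
    have ends: "norm (D i) \<le> B * (\<Sum>i<n. e i)" if "i < n" for i
      using D[of i] mult_left_mono[OF single[OF that] BU(1)] that by simp
    have "norm ((k / 2) *\<^sub>R D 0 + k *\<^sub>R (\<Sum>i = 1..<n. D i) + (k / 2) *\<^sub>R D (n - 1))
        \<le> (k / 2) * norm (D 0) + k * norm (\<Sum>i = 1..<n. D i) + (k / 2) * norm (D (n - 1))"
      using k by (intro norm_triangle_le add_mono) auto
    also have "\<dots> \<le> (k / 2) * (B * (\<Sum>i<n. e i)) + k * (B * (\<Sum>i<n. e i)) + (k / 2) * (B * (\<Sum>i<n. e i))"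
      using k ends[of 0] ends[of "n - 1"] mid Suc by (intro add_mono mult_left_mono) auto
    finally show ?thesis by (simp add: algebra_simps)
  qed
  ultimately have "norm (S - W) \<le> (B * U) * k\<^sup>2 + 2 * B * k * (\<Sum>i<n. e i)"
    by (simp add: norm_triangle_le)
  with quad have bound: "norm (integral {0..?t} g - W)
      \<le> (3 * T + 1) * (B * U) * k\<^sup>2 + 2 * B * k * (\<Sum>i<n. e i)"
    using norm_triangle_ineq[of "integral {0..?t} g - S" "S - W"] by (simp add: algebra_simps)
  have diff: "history_op R q a u ?t - history_discrete R q a k n v = R (integral {0..?t} g - W)"
    unfolding history_op_def history_discrete_def Let_def W_def Q_def g_def
    using Suc by (simp add: blinfun.bilinear_simps del: of_nat_Suc)
  show ?thesis unfolding diff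
    by (rule order_trans[OF norm_blinfun mult_left_mono]) (use bound in \<open>simp_all add: e_def\<close>)
qed

text \<open>On the compact square the kernel and its two derivatives are bounded, and the bounds are uniform in the
first variable.  This is what makes the constants below independent of the time step.\<close>

lemma C2_on_quadrant_sections:
  fixes q :: "real \<Rightarrow> real \<Rightarrow> 'b::real_normed_vector"
  assumes "C2_on ({0..} \<times> {0..}) (\<lambda>(t, s). q t s)" and T: "T \<ge> 0"
  obtains B where "B \<ge> 0" "\<And>t. t \<in> {0..T} \<Longrightarrow> B-lipschitz_on {0..T} (q t)"
      "\<And>t. t \<in> {0..T} \<Longrightarrow> nearly_affine_on B {0..T} (q t)"
      "\<And>t s. t \<in> {0..T} \<Longrightarrow> s \<in> {0..T} \<Longrightarrow> norm (q t s) \<le> B"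
proof -
  let ?S = "{0..T} \<times> {0..T}"
  let ?q = "\<lambda>(t, s). q t s"
  obtain D1 :: "real \<times> real \<Rightarrow> ((real \<times> real) \<Rightarrow>\<^sub>L 'b)" and D2 where D:
    "\<And>x. x \<in> {0..} \<times> {0..} \<Longrightarrow> (?q has_derivative blinfun_apply (D1 x)) (at x within {0..} \<times> {0..})"
    "\<And>x. x \<in> {0..} \<times> {0..} \<Longrightarrow> (D1 has_derivative blinfun_apply (D2 x)) (at x within {0..} \<times> {0..})"
    "continuous_on ({0..} \<times> {0..}) D2"
    using assms(1) unfolding C2_on_def by blast
  have sub: "?S \<subseteq> {0..} \<times> {0..}" by auto
  have D1: "(?q has_derivative blinfun_apply (D1 x)) (at x within ?S)"
    and D2: "(D1 has_derivative blinfun_apply (D2 x)) (at x within ?S)" if "x \<in> ?S" for x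
    using that sub by (auto intro: has_derivative_subset[OF D(1) sub] has_derivative_subset[OF D(2) sub])
  have S: "compact ?S" "convex ?S" by (auto intro: compact_Times convex_Times)
  have bdd: "bounded (?q ` ?S)" "bounded (D1 ` ?S)" "bounded (D2 ` ?S)"
    by (intro compact_imp_bounded compact_continuous_image S(1) has_derivative_continuous_on[OF D1]
          has_derivative_continuous_on[OF D2] continuous_on_subset[OF D(3) sub]; assumption)+
  obtain B0 where B0: "norm (?q x) \<le> B0" if "x \<in> ?S" for x
    using bdd(1) unfolding bounded_iff by blast
  obtain B1 where B1: "norm (D1 x) \<le> B1" if "x \<in> ?S" for x
    using bdd(2) unfolding bounded_iff by blast
  obtain B2 where B2: "norm (D2 x) \<le> B2" if "x \<in> ?S" for x
    using bdd(3) unfolding bounded_iff by blast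
  note B = B0 B1 B2
  have B_nonneg: "B0 \<ge> 0" "B1 \<ge> 0" "B2 \<ge> 0"
    using T by (auto intro!: order_trans[OF norm_ge_zero B(1)[of "(0, 0)"]]
        order_trans[OF norm_ge_zero B(2)[of "(0, 0)"]] order_trans[OF norm_ge_zero B(3)[of "(0, 0)"]])
  \<comment> \<open>The mean value inequality on the square, to be restricted to segments with fixed \<open>t\<close>.\<close>
  have D1_Lip: "norm (D1 x - D1 y) \<le> B2 * norm (x - y)" if "x \<in> ?S" "y \<in> ?S" for x y
    using that B(3) by (intro differentiable_bound[OF S(2) D2]) (auto simp: norm_blinfun.rep_eq)
  have q_Lip: "norm (?q x - ?q y) \<le> B1 * norm (x - y)" if "x \<in> ?S" "y \<in> ?S" for x y
    using that B(2) by (intro differentiable_bound[OF S(2) D1]) (auto simp: norm_blinfun.rep_eq)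
  let ?B = "B0 + B1 + 2 * B2"
  show ?thesis
  proof (rule that)
    show "?B \<ge> 0" using B_nonneg by simp
    show "norm (q t s) \<le> ?B" if "t \<in> {0..T}" "s \<in> {0..T}" for t s
      using B(1)[of "(t, s)"] that B_nonneg by simp
    fix t assume t: "t \<in> {0..T}"
    show "?B-lipschitz_on {0..T} (q t)"
    proof (rule lipschitz_onI)
      fix x y assume "x \<in> {0..T}" "y \<in> {0..T}"
      then have "norm (q t x - q t y) \<le> B1 * \<bar>x - y\<bar>"
        using q_Lip[of "(t, x)" "(t, y)"] t by (simp add: norm_Pair)
      also have "\<dots> \<le> ?B * \<bar>x - y\<bar>" using B_nonneg by (intro mult_right_mono) auto
      finally show "dist (q t x) (q t y) \<le> ?B * dist x y" by (simp add: dist_norm)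
    qed (use B_nonneg in simp)
    have "nearly_affine_on (2 * B2) {0..T} (q t)"
    proof (rule Lipschitz_derivative_imp_nearly_affine)
      fix s assume s: "s \<in> {0..T}"
      have "((\<lambda>s. (t, s)) has_derivative (\<lambda>d. (0, d))) (at s within {0..T})"
        by (auto intro!: derivative_eq_intros)
      moreover have "(?q has_derivative blinfun_apply (D1 (t, s))) (at (t, s) within (\<lambda>s. (t, s)) ` {0..T})"
        by (rule has_derivative_subset[OF D1]) (use t s in auto)
      ultimately have "((\<lambda>s. ?q (t, s)) has_derivative (\<lambda>d. D1 (t, s) (0, d))) (at s within {0..T})"
        by (rule has_derivative_in_compose)
      moreover have "(\<lambda>d. D1 (t, s) (0, d)) = (\<lambda>d. d *\<^sub>R D1 (t, s) (0, 1))"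
        by (rule ext) (simp flip: blinfun.scaleR_right)
      ultimately show "(q t has_vector_derivative D1 (t, s) (0, 1)) (at s within {0..T})"
        by (simp add: has_vector_derivative_def)
    next
      show "B2-lipschitz_on {0..T} (\<lambda>s. D1 (t, s) (0, 1))"
      proof (rule lipschitz_onI)
        fix x y assume xy: "x \<in> {0..T}" "y \<in> {0..T}"
        have "D1 (t, x) (0, 1) - D1 (t, y) (0, 1) = (D1 (t, x) - D1 (t, y)) (0, 1)"
          by (simp add: blinfun.diff_left)
        also have "norm \<dots> \<le> norm (D1 (t, x) - D1 (t, y)) * norm (0::real, 1::real)"
          by (rule norm_blinfun)
        also have "\<dots> \<le> B2 * norm ((t, x) - (t, y))"
          using D1_Lip[of "(t, x)" "(t, y)"] t xy by (simp add: norm_Pair)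
        finally show "dist (D1 (t, x) (0, 1)) (D1 (t, y) (0, 1)) \<le> B2 * dist x y"
          by (simp add: dist_norm norm_Pair)
      qed (rule B_nonneg)
    qed
    then show "nearly_affine_on ?B {0..T} (q t)"
    proof -
      have "2 * B2 * (b - a)\<^sup>2 \<le> ?B * (b - a)\<^sup>2" for a b :: real
        using B_nonneg by (intro mult_right_mono) auto
      then show ?thesis using \<open>nearly_affine_on (2 * B2) {0..T} (q t)\<close>
        unfolding nearly_affine_on_def by (meson order_trans)
    qed
  qed
qed

section \<open>Stability of one step and propagation of errors\<close>

text \<open>The claim is that \<open>D k\<^sup>2 \<rho>^n\<close> with \<open>D = C / (1 - 3 \<theta>)\<close> and \<open>\<rho> = 1 + D k\<close> dominates the errors.  The
extrapolated terms use up the fraction \<open>3 \<theta>\<close> of it.  The geometric series \<open>k D\<close> times the sum of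
\<open>\<rho>^i\<close> telescopes to \<open>\<rho>^n - 1\<close>, and the \<open>- 1\<close> absorbs the inhomogeneous term \<open>k\<^sup>2\<close>; what is left is
\<open>C k\<^sup>2 \<rho>^n\<close>, which is the remaining fraction \<open>1 - 3 \<theta>\<close>.\<close>

lemma extrapolation_recursion_bound:
  fixes e :: "nat \<Rightarrow> real"
  assumes \<theta>: "0 \<le> \<theta>" "3 * \<theta> < 1" and C: "C > 0" and k: "k > 0"
    and start: "\<And>n. n \<le> N \<Longrightarrow> n < 2 \<Longrightarrow> e n \<le> C * (k\<^sup>2 + k * (\<Sum>i<n. e i))"
    and step: "\<And>n. n \<le> N \<Longrightarrow> 2 \<le> n \<Longrightarrow>
      e n \<le> \<theta> * (2 * e (n - 1) + e (n - 2)) + C * (k\<^sup>2 + k * (\<Sum>i<n. e i))"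
    and n: "n \<le> N"
  shows "e n \<le> C / (1 - 3 * \<theta>) * k\<^sup>2 * (1 + C / (1 - 3 * \<theta>) * k) ^ n"
  using n
proof (induction n rule: less_induct)
  case (less n)
  define D where "D = C / (1 - 3 * \<theta>)"
  define \<rho> where "\<rho> = 1 + D * k"
  have D: "D > 0" "C = (1 - 3 * \<theta>) * D" using \<theta> C by (simp_all add: D_def)
  have \<rho>: "\<rho> > 1" using D k by (simp add: \<rho>_def)
  have CD: "C \<le> D" unfolding D(2) using \<theta> D(1) mult_right_mono[of "1 - 3 * \<theta>" 1 D] by simp
  have IH: "e i \<le> D * k\<^sup>2 * \<rho> ^ i" if "i < n" for i
    using less that by (auto simp: D_def \<rho>_def)
  have mono: "D * k\<^sup>2 * \<rho> ^ i \<le> D * k\<^sup>2 * \<rho> ^ n" if "i \<le> n" for i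
    using that \<rho> D by (intro mult_left_mono power_increasing) auto
  have "(\<Sum>i<n. e i) \<le> (\<Sum>i<n. D * k\<^sup>2 * \<rho> ^ i)" by (intro sum_mono IH) auto
  also have "\<dots> = D * k\<^sup>2 * (\<Sum>i<n. \<rho> ^ i)" by (simp add: sum_distrib_left)
  finally have "k * (\<Sum>i<n. e i) \<le> k * (D * k\<^sup>2 * (\<Sum>i<n. \<rho> ^ i))"
    using k by (intro mult_left_mono) auto
  also have "\<dots> = k\<^sup>2 * ((\<rho> - 1) * (\<Sum>i<n. \<rho> ^ i))" by (simp add: \<rho>_def)
  also have "\<dots> = k\<^sup>2 * (\<rho> ^ n - 1)" by (simp add: power_diff_1_eq)
  finally have "k\<^sup>2 + k * (\<Sum>i<n. e i) \<le> k\<^sup>2 * \<rho> ^ n" by (simp add: algebra_simps)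
  then have history: "C * (k\<^sup>2 + k * (\<Sum>i<n. e i)) \<le> C * (k\<^sup>2 * \<rho> ^ n)"
    using C by (intro mult_left_mono) auto
  have "e n \<le> D * k\<^sup>2 * \<rho> ^ n"
  proof (cases "n < 2")
    case True
    have "e n \<le> C * (k\<^sup>2 * \<rho> ^ n)" using start[OF less.prems True] history by linarith
    also have "\<dots> \<le> D * (k\<^sup>2 * \<rho> ^ n)" using CD \<rho> by (intro mult_right_mono) auto
    finally show ?thesis by (simp add: mult.assoc)
  next
    case False
    have "2 * e (n - 1) + e (n - 2) \<le> 3 * (D * k\<^sup>2 * \<rho> ^ n)"
      using order_trans[OF IH mono, of "n - 1"] order_trans[OF IH mono, of "n - 2"] False by simp
    then have "\<theta> * (2 * e (n - 1) + e (n - 2)) \<le> \<theta> * (3 * (D * k\<^sup>2 * \<rho> ^ n))"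
      using \<theta> by (intro mult_left_mono) auto
    then have "e n \<le> \<theta> * (3 * (D * k\<^sup>2 * \<rho> ^ n)) + C * (k\<^sup>2 * \<rho> ^ n)"
      using step[OF less.prems] history False by simp
    also have "\<dots> = D * k\<^sup>2 * \<rho> ^ n" unfolding D(2) by (simp add: algebra_simps)
    finally show ?thesis .
  qed
  then show ?case by (simp add: D_def \<rho>_def)
qed

locale hemivariational_data =
  fixes K :: "'x::real_normed_vector set"
    and A :: "'x \<Rightarrow> 'x \<Rightarrow>\<^sub>L real"
    and \<phi> :: "'y::real_normed_vector \<Rightarrow> 'x \<Rightarrow> 'x \<Rightarrow> real"
    and j :: "'xj::real_normed_vector \<Rightarrow> real"
    and \<gamma> :: "'x \<Rightarrow>\<^sub>L 'xj"
    and jc :: "'xj \<Rightarrow> 'xj \<Rightarrow>\<^sub>L real"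
    and c m \<alpha> \<beta> \<alpha>j \<alpha>c :: real
  assumes \<gamma>_bound: "norm (\<gamma> v) \<le> c * norm v"
    and A_strongly_monotone: "(A v1 - A v2) (v1 - v2) \<ge> m * (norm (v1 - v2))\<^sup>2"
    and \<phi>_estimate: "u1 \<in> K \<Longrightarrow> u2 \<in> K \<Longrightarrow> v1 \<in> K \<Longrightarrow> v2 \<in> K \<Longrightarrow>
         \<phi> y1 u1 v2 - \<phi> y1 u1 v1 + \<phi> y2 u2 v1 - \<phi> y2 u2 v2
           \<le> \<alpha> * norm (u1 - u2) * norm (v1 - v2) + \<beta> * norm (y1 - y2) * norm (v1 - v2)"
    and j_estimate: "clarke_deriv j z1 (z2 - z1) + clarke_deriv j z2 (z1 - z2) \<le> \<alpha>j * (norm (z1 - z2))\<^sup>2"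
    and jc_linear: "linear jc"
    and jc_bound: "\<alpha>c \<ge> 0" "norm (jc z) \<le> \<alpha>c * norm z"
    and jc_coercive: "jc z z \<ge> \<alpha>j * (norm z)\<^sup>2"
begin

lemma jc_\<gamma>_bound: "\<bar>jc (\<gamma> v) (\<gamma> w)\<bar> \<le> \<alpha>c * c\<^sup>2 * (norm v * norm w)"
proof -
  have "\<bar>jc (\<gamma> v) (\<gamma> w)\<bar> \<le> norm (jc (\<gamma> v)) * norm (\<gamma> w)"
    using norm_blinfun[of "jc (\<gamma> v)" "\<gamma> w"] by simp
  also have "\<dots> \<le> (\<alpha>c * (c * norm v)) * (c * norm w)"
    using order_trans[OF jc_bound(2)[of "\<gamma> v"] mult_left_mono[OF \<gamma>_bound[of v] jc_bound(1)]]
      order_trans[OF norm_ge_zero \<gamma>_bound[of v]] jc_bound(1)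
    by (intro mult_mono \<gamma>_bound) auto
  finally show ?thesis by (simp add: power2_eq_square mult_ac)
qed

lemma cancel_norm_factor:
  fixes d :: 'x
  assumes "m * (norm d)\<^sup>2 \<le> B * norm d" "B \<ge> 0"
  shows "m * norm d \<le> B"
  using assms by (cases "d = 0") (auto simp: power2_eq_square mult.assoc[symmetric])

text \<open>The exact solution satisfies the implicit inequality with the exact history value \<open>S\<close>, the iterate
\<open>w\<close> the extrapolated one with \<open>S'\<close>.  The coercivity of \<open>jc\<close> on \<open>\<gamma> (u - w)\<close> cancels the defect of
monotonicity \<open>\<alpha>j\<close>.\<close>

lemma extrapolated_step_stability:
  assumes u: "implicit_step K A \<phi> j \<gamma> S fn u"
    and w: "extrapolated_step K A \<phi> j \<gamma> jc S' fn w2 w1 w"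
    and nonneg: "\<alpha> \<ge> 0" "\<beta> \<ge> 0"
  shows "m * norm (u - w) \<le> (\<alpha> + \<alpha>c * c\<^sup>2) * norm (u - (2 *\<^sub>R w1 - w2)) + \<beta> * norm (S - S')"
proof (rule cancel_norm_factor)
  let ?x = "2 *\<^sub>R w1 - w2"
  have K: "u \<in> K" "w \<in> K" "?x \<in> K"
    using u w unfolding implicit_step_def extrapolated_step_def by auto
  have 1: "A u (w - u) + \<phi> S u w - \<phi> S u u + clarke_deriv j (\<gamma> u) (\<gamma> w - \<gamma> u) \<ge> fn (w - u)"
    using u K unfolding implicit_step_def by blast
  have 2: "A w (u - w) + \<phi> S' ?x u - \<phi> S' ?x w + clarke_deriv j (\<gamma> w) (\<gamma> u - \<gamma> w)
      + jc (\<gamma> w) (\<gamma> u - \<gamma> w) \<ge> jc (2 *\<^sub>R \<gamma> w1 - \<gamma> w2) (\<gamma> u - \<gamma> w) + fn (u - w)"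
    using w K unfolding extrapolated_step_def by blast
  have f: "fn (w - u) + fn (u - w) = 0" by (simp add: blinfun.diff_right)
  have A: "A u (w - u) + A w (u - w) \<le> - (m * (norm (u - w))\<^sup>2)"
    using A_strongly_monotone[of u w] by (simp add: blinfun.bilinear_simps)
  have \<phi>: "\<phi> S u w - \<phi> S u u + \<phi> S' ?x u - \<phi> S' ?x w
      \<le> \<alpha> * norm (u - ?x) * norm (u - w) + \<beta> * norm (S - S') * norm (u - w)"
    by (rule \<phi>_estimate) (use K in auto)
  have j: "clarke_deriv j (\<gamma> u) (\<gamma> w - \<gamma> u) + clarke_deriv j (\<gamma> w) (\<gamma> u - \<gamma> w)
      \<le> \<alpha>j * (norm (\<gamma> (u - w)))\<^sup>2"
    using j_estimate[of "\<gamma> u" "\<gamma> w"] by (simp add: blinfun.diff_right)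
  have "\<gamma> w - (2 *\<^sub>R \<gamma> w1 - \<gamma> w2) = \<gamma> (u - ?x) - \<gamma> (u - w)"
    by (simp add: blinfun.bilinear_simps)
  then have "jc (\<gamma> w) - jc (2 *\<^sub>R \<gamma> w1 - \<gamma> w2) = jc (\<gamma> (u - ?x)) - jc (\<gamma> (u - w))"
    by (simp only: linear_diff[OF jc_linear, symmetric])
  then have "jc (\<gamma> w) (\<gamma> (u - w)) - jc (2 *\<^sub>R \<gamma> w1 - \<gamma> w2) (\<gamma> (u - w))
      = jc (\<gamma> (u - ?x)) (\<gamma> (u - w)) - jc (\<gamma> (u - w)) (\<gamma> (u - w))"
    by (metis blinfun.diff_left)
  then have jc: "jc (\<gamma> w) (\<gamma> u - \<gamma> w) - jc (2 *\<^sub>R \<gamma> w1 - \<gamma> w2) (\<gamma> u - \<gamma> w)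
      \<le> \<alpha>c * c\<^sup>2 * (norm (u - ?x) * norm (u - w)) - \<alpha>j * (norm (\<gamma> (u - w)))\<^sup>2"
    using jc_\<gamma>_bound[of "u - ?x" "u - w"] jc_coercive[of "\<gamma> (u - w)"]
    by (simp add: blinfun.diff_right[of \<gamma> u w])
  have "m * (norm (u - w))\<^sup>2 \<le> \<alpha> * norm (u - ?x) * norm (u - w) + \<beta> * norm (S - S') * norm (u - w)
      + \<alpha>c * c\<^sup>2 * (norm (u - ?x) * norm (u - w))"
    using 1 2 f A \<phi> j jc by linarith
  then show "m * (norm (u - w))\<^sup>2
      \<le> ((\<alpha> + \<alpha>c * c\<^sup>2) * norm (u - ?x) + \<beta> * norm (S - S')) * norm (u - w)"
    by (simp add: algebra_simps)
  show "0 \<le> (\<alpha> + \<alpha>c * c\<^sup>2) * norm (u - ?x) + \<beta> * norm (S - S')"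
    using nonneg jc_bound(1) by simp
qed

text \<open>If both older iterates equal \<open>w\<close>, the extrapolated point is \<open>w\<close> and the two \<open>jc\<close> terms cancel: the
implicit step is an extrapolated step.\<close>

lemma implicit_step_stability:
  assumes u: "implicit_step K A \<phi> j \<gamma> S fn u" and w: "implicit_step K A \<phi> j \<gamma> S' fn w"
    and nonneg: "\<alpha> \<ge> 0" "\<beta> \<ge> 0"
  shows "m * norm (u - w) \<le> (\<alpha> + \<alpha>c * c\<^sup>2) * norm (u - w) + \<beta> * norm (S - S')"
proof -
  have K: "u \<in> K" "w \<in> K" using u w unfolding implicit_step_def by auto
  have "2 *\<^sub>R w - w = w" "2 *\<^sub>R \<gamma> w - \<gamma> w = \<gamma> w" by (simp_all add: scaleR_2)
  then have "extrapolated_step K A \<phi> j \<gamma> jc S' fn w w w"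
    using w unfolding implicit_step_def extrapolated_step_def by force
  from extrapolated_step_stability[OF u this nonneg] show ?thesis
    using \<open>2 *\<^sub>R w - w = w\<close> by simp
qed

end

section \<open>Second order convergence\<close>

theorem theorem19:
  fixes K :: "'x::banach set"
    and \<gamma>\<^sub>j :: "'x \<Rightarrow>\<^sub>L 'xj::banach"
    and A :: "'x \<Rightarrow> 'x \<Rightarrow>\<^sub>L real"
    and \<phi> :: "'y::real_normed_vector \<Rightarrow> 'x \<Rightarrow> 'x \<Rightarrow> real"
    and j :: "'xj \<Rightarrow> real"
    and f :: "real \<Rightarrow> 'x \<Rightarrow>\<^sub>L real"
    and R :: "'x \<Rightarrow>\<^sub>L 'y"
    and q :: "real \<Rightarrow> real \<Rightarrow> 'x \<Rightarrow>\<^sub>L 'x"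
    and a\<^sub>S :: 'x
    and j\<^sub>c :: "'xj \<Rightarrow> 'xj \<Rightarrow>\<^sub>L real"
    and u :: "real \<Rightarrow> 'x"
    and c\<^sub>j L\<^sub>A m\<^sub>A \<alpha>\<^sub>\<phi> \<beta>\<^sub>\<phi> c\<^sub>0 c\<^sub>1 \<alpha>\<^sub>j \<alpha>\<^sub>c T :: real
  assumes X: "reflexive_space TYPE('x)"
    and K: "closed K" "convex K" "0 \<in> K"
    and \<gamma>: "c\<^sub>j > 0" "\<And>v. norm (\<gamma>\<^sub>j v) \<le> c\<^sub>j * norm v"
    and A_Lipschitz: "L\<^sub>A > 0" "L\<^sub>A-lipschitz_on UNIV A"
    and A_monotone: "m\<^sub>A > 0"
      "\<And>v1 v2. (A v1 - A v2) (v1 - v2) \<ge> m\<^sub>A * (norm (v1 - v2))\<^sup>2"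
    and \<phi>_convex: "\<And>y w. w \<in> K \<Longrightarrow> convex_on K (\<phi> y w)"
    and \<phi>_lsc: "\<And>y w. w \<in> K \<Longrightarrow> lsc_on K (\<phi> y w)"
    and \<phi>_bound: "\<alpha>\<^sub>\<phi> > 0" "\<beta>\<^sub>\<phi> > 0"
      "\<And>y1 y2 u1 u2 v1 v2. u1 \<in> K \<Longrightarrow> u2 \<in> K \<Longrightarrow> v1 \<in> K \<Longrightarrow> v2 \<in> K \<Longrightarrow>
         \<phi> y1 u1 v2 - \<phi> y1 u1 v1 + \<phi> y2 u2 v1 - \<phi> y2 u2 v2
           \<le> \<alpha>\<^sub>\<phi> * norm (u1 - u2) * norm (v1 - v2) + \<beta>\<^sub>\<phi> * norm (y1 - y2) * norm (v1 - v2)"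
    and j_Lipschitz: "locally_Lipschitz j"
    and j_growth: "c\<^sub>0 \<ge> 0" "c\<^sub>1 \<ge> 0"
      "\<And>z \<xi>. \<xi> \<in> clarke_subdiff j z \<Longrightarrow> norm \<xi> \<le> c\<^sub>0 + c\<^sub>1 * norm z"
    and j_relaxed: "\<alpha>\<^sub>j > 0"
      "\<And>z1 z2. clarke_deriv j z1 (z2 - z1) + clarke_deriv j z2 (z1 - z2)
                 \<le> \<alpha>\<^sub>j * (norm (z1 - z2))\<^sup>2"
    and f: "continuous_on {0..} f"
    and q: "continuous_on ({0..} \<times> {0..}) (\<lambda>(t, s). q t s)"
    and j\<^sub>c_linear: "linear j\<^sub>c"
    and j\<^sub>c_bound: "\<alpha>\<^sub>c \<ge> 0" "\<And>z. norm (j\<^sub>c z) \<le> \<alpha>\<^sub>c * norm z"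
    and j\<^sub>c_coercive: "\<And>z. j\<^sub>c z z \<ge> \<alpha>\<^sub>j * (norm z)\<^sup>2"
    and small: "\<alpha>\<^sub>\<phi> + \<alpha>\<^sub>c * c\<^sub>j\<^sup>2 < m\<^sub>A / 3"
    and q_C2: "C2_on ({0..} \<times> {0..}) (\<lambda>(t, s). q t s)"
    and u_continuous: "continuous_on {0..} u"
    and u_K: "\<And>t. t \<ge> 0 \<Longrightarrow> u t \<in> K"
    and u_solution: "\<And>t v. t \<ge> 0 \<Longrightarrow> v \<in> K \<Longrightarrow>
         A (u t) (v - u t)
           + \<phi> (history_op R q a\<^sub>S u t) (u t) v - \<phi> (history_op R q a\<^sub>S u t) (u t) (u t)
           + clarke_deriv j (\<gamma>\<^sub>j (u t)) (\<gamma>\<^sub>j v - \<gamma>\<^sub>j (u t))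
         \<ge> f t (v - u t)"
    and u_regular: "W2inf_loc u"
    and T: "T > 0"
  shows "\<exists>C\<^sub>5>0. \<forall>(N::nat) k (uk :: nat \<Rightarrow> 'x).
     N > 0 \<longrightarrow> k = T / real N \<longrightarrow>
     (\<forall>n\<le>N. uk n \<in> K) \<longrightarrow>
     (\<forall>n\<in>{0, 1}. implicit_step K A \<phi> j \<gamma>\<^sub>j
        (history_discrete R q a\<^sub>S k n uk) (f (real n * k)) (uk n)) \<longrightarrow>
     (\<forall>n\<in>{2..N}. extrapolated_step K A \<phi> j \<gamma>\<^sub>j j\<^sub>c
        (history_discrete R q a\<^sub>S k n uk) (f (real n * k)) (uk (n - 2)) (uk (n - 1)) (uk n)) \<longrightarrow>
     (MAX n\<in>{..N}. norm (u (real n * k) - uk n)) \<le> C\<^sub>5 * k\<^sup>2"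
proof -
  interpret hemivariational_data K A \<phi> j \<gamma>\<^sub>j j\<^sub>c c\<^sub>j m\<^sub>A \<alpha>\<^sub>\<phi> \<beta>\<^sub>\<phi> \<alpha>\<^sub>j \<alpha>\<^sub>c
    by (rule hemivariational_data.intro) (fact \<gamma>(2) A_monotone(2) \<phi>_bound(3) j_relaxed(2) j\<^sub>c_linear j\<^sub>c_bound j\<^sub>c_coercive)+
  obtain U where U: "U \<ge> 0" "U-lipschitz_on {0..T} u" "nearly_affine_on U {0..T} u"
      "\<And>s. s \<in> {0..T} \<Longrightarrow> norm (u s) \<le> U"
    using W2inf_loc_imp_Lipschitz_nearly_affine[OF u_regular u_continuous T] by blast
  obtain B where B: "B \<ge> 0" "\<And>t. t \<in> {0..T} \<Longrightarrow> B-lipschitz_on {0..T} (q t)"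
      "\<And>t. t \<in> {0..T} \<Longrightarrow> nearly_affine_on B {0..T} (q t)"
      "\<And>t s. t \<in> {0..T} \<Longrightarrow> s \<in> {0..T} \<Longrightarrow> norm (q t s) \<le> B"
    using C2_on_quadrant_sections[OF q_C2 less_imp_le[OF T]] by blast
  define \<sigma> where "\<sigma> = \<alpha>\<^sub>\<phi> + \<alpha>\<^sub>c * c\<^sub>j\<^sup>2"
  define \<theta> where "\<theta> = \<sigma> / m\<^sub>A"
  define b where "b = \<beta>\<^sub>\<phi> / m\<^sub>A"
  define H1 where "H1 = norm R * ((3 * T + 1) * (B * U))"
  define H2 where "H2 = norm R * (2 * B)"
  \<comment> \<open>The second difference spans an interval of length \<open>2 k\<close> and is twice the distance to the chord, hence \<open>8 U\<close>; the factor \<open>2\<close> comes from the implicit steps, where the current error on the right has weight \<open>\<theta> < 1/2\<close> and is absorbed; the \<open>1\<close> ensures positivity.\<close>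
  define C where "C = 8 * U + 2 * b * (H1 + H2) + 1"
  define D where "D = C / (1 - 3 * \<theta>)"
  have \<sigma>: "0 \<le> \<sigma>" "3 * \<sigma> < m\<^sub>A" using less_imp_le[OF \<phi>_bound(1)] j\<^sub>c_bound(1) small by (simp_all add: \<sigma>_def)
  have \<theta>: "0 \<le> \<theta>" "3 * \<theta> < 1" "\<sigma> = m\<^sub>A * \<theta>"
    using \<sigma> A_monotone(1) by (simp_all add: \<theta>_def)
  have b: "0 \<le> b" "\<beta>\<^sub>\<phi> = m\<^sub>A * b" using \<phi>_bound(2) A_monotone(1) by (simp_all add: b_def)
  have H: "0 \<le> H1" "0 \<le> H2" using B(1) U(1) T by (simp_all add: H1_def H2_def)
  have C: "C > 0" using U(1) b H by (auto simp: C_def intro!: add_nonneg_pos)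
  have D: "D > 0" using C \<theta> by (simp add: D_def)
  have main: "norm (u (real n * k) - uk n) \<le> D * exp (D * T) * k\<^sup>2"
    if N: "N > 0" "k = T / real N" "n \<le> N"
      and start: "\<forall>n\<in>{0, 1}. implicit_step K A \<phi> j \<gamma>\<^sub>j
        (history_discrete R q a\<^sub>S k n uk) (f (real n * k)) (uk n)"
      and steps: "\<forall>n\<in>{2..N}. extrapolated_step K A \<phi> j \<gamma>\<^sub>j j\<^sub>c
        (history_discrete R q a\<^sub>S k n uk) (f (real n * k)) (uk (n - 2)) (uk (n - 1)) (uk n)"
    for N n :: nat and k and uk :: "nat \<Rightarrow> 'x"
  proof -
    have k: "k > 0" "real N * k = T" using N T by simp_all
    have grid: "real i * k \<in> {0..T}" if "i \<le> N" for i
    proof -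
      have "real i * k \<le> real N * k" using that k(1) by (intro mult_right_mono) simp_all
      then show ?thesis unfolding k(2) using k(1) by simp
    qed
    define e where "e i = norm (u (real i * k) - uk i)" for i
    define h where "h i = k\<^sup>2 + k * (\<Sum>l<i. e l)" for i
    have h: "0 \<le> k\<^sup>2" "0 \<le> k * (\<Sum>l<i. e l)" for i using k by (simp_all add: e_def sum_nonneg)
    have exact: "implicit_step K A \<phi> j \<gamma>\<^sub>j (history_op R q a\<^sub>S u (real i * k)) (f (real i * k)) (u (real i * k))"
      if "i \<le> N" for i
      unfolding implicit_step_def using u_K u_solution grid[OF that] by auto
    have history: "norm (history_op R q a\<^sub>S u (real i * k) - history_discrete R q a\<^sub>S k i uk)
        \<le> (H1 + H2) * h i" if "i \<le> N" for i
    proof -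
      have "norm (history_op R q a\<^sub>S u (real i * k) - history_discrete R q a\<^sub>S k i uk)
          \<le> H1 * k\<^sup>2 + H2 * (k * (\<Sum>l<i. e l))"
        using history_error[OF B(2-4) U(2-4) k(1), where n = i and R = R and a = a\<^sub>S and v = uk] grid[OF that]
        by (simp add: H1_def H2_def e_def algebra_simps)
      also have "\<dots> \<le> (H1 + H2) * k\<^sup>2 + (H1 + H2) * (k * (\<Sum>l<i. e l))"
        using H h by (intro add_mono mult_right_mono) auto
      finally show ?thesis by (simp add: h_def distrib_left)
    qed
    have "e n \<le> C / (1 - 3 * \<theta>) * k\<^sup>2 * (1 + C / (1 - 3 * \<theta>) * k) ^ n"
    proof (rule extrapolation_recursion_bound[OF \<theta>(1,2) C k(1) _ _ N(3)])
      fix i assume i: "i \<le> N" "i < 2"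
      have "i \<in> {0, 1}" using i by auto
      then have "m\<^sub>A * e i \<le> \<sigma> * e i + \<beta>\<^sub>\<phi> * norm (history_op R q a\<^sub>S u (real i * k) - history_discrete R q a\<^sub>S k i uk)"
        unfolding e_def \<sigma>_def using start \<phi>_bound(1,2)
        by (intro implicit_step_stability[OF exact[OF i(1)]]) auto
      also have "\<dots> \<le> \<sigma> * e i + \<beta>\<^sub>\<phi> * ((H1 + H2) * h i)"
        using \<phi>_bound(2) history[OF i(1)] by (intro add_left_mono mult_left_mono) auto
      also have "\<dots> = m\<^sub>A * (\<theta> * e i + b * ((H1 + H2) * h i))"
        by (simp add: \<theta>(3) b(2) algebra_simps)
      finally have "e i \<le> \<theta> * e i + b * (H1 + H2) * h i" using A_monotone(1) by (simp add: mult.assoc)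
      moreover have "\<theta> * e i \<le> (1 / 2) * e i" using \<theta> by (intro mult_right_mono) (auto simp: e_def)
      ultimately have "e i \<le> 2 * b * (H1 + H2) * h i" by simp
      also have "\<dots> \<le> C * h i" using U(1) h by (intro mult_right_mono) (auto simp: C_def h_def)
      finally show "e i \<le> C * (k\<^sup>2 + k * (\<Sum>l<i. e l))" by (simp add: h_def)
    next
      fix i assume i: "i \<le> N" "2 \<le> i"
      let ?x = "2 *\<^sub>R uk (i - 1) - uk (i - 2)"
      let ?d = "u (real i * k) - 2 *\<^sub>R u (real (i - 1) * k) + u (real (i - 2) * k)"
      have real_i: "real (i - 1) = real i - 1" "real (i - 2) = real i - 2" using i by (simp_all add: of_nat_diff)
      have d: "norm ?d \<le> 8 * U * k\<^sup>2"
      proof -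
        have mid: "(1 - 1 / 2) * (real (i - 2) * k) + 1 / 2 * (real i * k) = real (i - 1) * k"
          unfolding real_i by (simp add: field_simps)
        have "?d = (- 2) *\<^sub>R (u (real (i - 1) * k)
            - ((1 - 1 / 2) *\<^sub>R u (real (i - 2) * k) + (1 / 2) *\<^sub>R u (real i * k)))"
          by (simp add: scaleR_diff_right scaleR_add_right)
        also have "norm \<dots> \<le> 2 * (U * (real i * k - real (i - 2) * k)\<^sup>2)"
          using nearly_affine_onD[OF U(3) grid[of "i - 2"] grid[OF i(1)], of "1 / 2"] i
          unfolding mid by simp
        also have "real i * k - real (i - 2) * k = 2 * k" unfolding real_i by (simp add: algebra_simps)
        finally show ?thesis by (simp add: power_mult_distrib)
      qed
      have "norm (u (real i * k) - ?x) \<le> norm ?d + (2 * e (i - 1) + e (i - 2))"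
      proof -
        have "u (real i * k) - ?x = ?d - (- (2 *\<^sub>R (u (real (i - 1) * k) - uk (i - 1))))
            - (u (real (i - 2) * k) - uk (i - 2))"
          by (simp add: scaleR_diff_right)
        then have "norm (u (real i * k) - ?x) \<le> norm ?d + norm (- (2 *\<^sub>R (u (real (i - 1) * k) - uk (i - 1))))
            + norm (u (real (i - 2) * k) - uk (i - 2))"
          by (simp only: norm_diff_diff_le)
        then show ?thesis by (simp add: e_def)
      qed
      with d have x: "norm (u (real i * k) - ?x) \<le> 8 * U * k\<^sup>2 + (2 * e (i - 1) + e (i - 2))" by linarith
      have "m\<^sub>A * e i \<le> \<sigma> * norm (u (real i * k) - ?x)
          + \<beta>\<^sub>\<phi> * norm (history_op R q a\<^sub>S u (real i * k) - history_discrete R q a\<^sub>S k i uk)"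
        unfolding e_def \<sigma>_def using steps i \<phi>_bound(1,2)
        by (intro extrapolated_step_stability[OF exact[OF i(1)]]) auto
      also have "\<dots> \<le> \<sigma> * (8 * U * k\<^sup>2 + (2 * e (i - 1) + e (i - 2))) + \<beta>\<^sub>\<phi> * ((H1 + H2) * h i)"
        using \<phi>_bound(2) history[OF i(1)] \<sigma>(1) x by (intro add_mono mult_left_mono) auto
      also have "\<dots> = m\<^sub>A * (\<theta> * (8 * U * k\<^sup>2 + (2 * e (i - 1) + e (i - 2))) + b * ((H1 + H2) * h i))"
        by (simp add: \<theta>(3) b(2) algebra_simps)
      finally have "e i \<le> \<theta> * (8 * U * k\<^sup>2 + (2 * e (i - 1) + e (i - 2))) + b * ((H1 + H2) * h i)"
        using A_monotone(1) by simp
      also have "\<dots> = \<theta> * (2 * e (i - 1) + e (i - 2)) + (\<theta> * (8 * U * k\<^sup>2) + b * (H1 + H2) * h i)"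
        by (simp add: algebra_simps)
      also have "\<theta> * (8 * U * k\<^sup>2) + b * (H1 + H2) * h i \<le> 8 * U * h i + 2 * b * (H1 + H2) * h i"
      proof (rule add_mono)
        have "\<theta> * (8 * U * k\<^sup>2) \<le> 1 * (8 * U * h i)"
          using \<theta> U(1) h(1) h(2)[of i] by (intro mult_mono) (auto simp: h_def)
        then show "\<theta> * (8 * U * k\<^sup>2) \<le> 8 * U * h i" by simp
        show "b * (H1 + H2) * h i \<le> 2 * b * (H1 + H2) * h i"
          using b H h(1) h(2)[of i] by (intro mult_right_mono) (auto simp: h_def)
      qed
      also have "8 * U * h i + 2 * b * (H1 + H2) * h i \<le> C * h i"
        using h(1) h(2)[of i] by (simp add: C_def distrib_right h_def)
      finally show "e i \<le> \<theta> * (2 * e (i - 1) + e (i - 2)) + C * (k\<^sup>2 + k * (\<Sum>l<i. e l))"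
        by (simp add: h_def)
    qed
    also have "\<dots> = D * k\<^sup>2 * (1 + D * k) ^ n" by (simp add: D_def)
    also have "\<dots> \<le> D * k\<^sup>2 * exp (D * T)"
    proof (intro mult_left_mono)
      have "(1 + D * k) ^ n \<le> exp (D * k) ^ n"
        using D k by (intro power_mono) auto
      also have "\<dots> = exp (D * (real n * k))" by (simp add: exp_of_nat_mult[symmetric] mult_ac)
      also have "\<dots> \<le> exp (D * T)" using D grid[OF N(3)] by simp
      finally show "(1 + D * k) ^ n \<le> exp (D * T)" .
    qed (use D in auto)
    finally show ?thesis by (simp add: e_def mult_ac)
  qed
  show ?thesis
  proof (intro exI[of _ "D * exp (D * T)"] conjI allI impI)
    show "0 < D * exp (D * T)" using D by simp
  qed (use main in \<open>auto intro!: Max.boundedI\<close>)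
qed

end
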